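(* Let $n$ and $t$ be positive integers. If $t=2t'$ is even, then $$\sum_{\substack{\lambda \in DD,\ |\lambda|=tn\\ \#\mathcal{H}_t(\lambda)=n}}\delta_\lambda\prod_{h \in \mathcal{H}_t(\lambda)}\frac{t}{h\,\varepsilon_h}=[x^{t'n}]\exp\left(-x^{t'}-\frac{tx^{t}}{2}\right),$$ and if $t=2t'+1$ is odd, then $$\sum_{\substack{\lambda \in SC,\ |\lambda|=tn\\ \#\mathcal{H}_t(\lambda)=n}}\delta_\lambda\prod_{h \in \mathcal{H}_t(\lambda)}\frac{t}{h\,\varepsilon_h}=[x^{tn}]\exp\left(-x^{t}-\frac{tx^{2t}}{2}\right).$$ Here $[x^m]F(x)$ denotes the coefficient of $x^m$ in the power series $F(x)$.
   Context: A partition $\lambda=(\lambda_1,\ldots,\lambda_\ell)$ is a finite non-increasing sequence of positive integers; its weight is $|\lambda|=\sum_i\lambda_i$. Its Ferrers diagram (French convention: row $1$ at the bottom) is the set of boxes $(j,k)$ with $1\le j\le \ell$ (row index) and $1\le k\le \lambda_j$ (column index). The hook of a box $v$ consists of $v$, the boxes in the same row to its right, and the boxes in the same column above it (larger row index); the hook length $h_v$ is the number of boxes in the hook. $\mathcal{H}_t(\lambda)$ is the multi-set of hook lengths of $\lambda$ which are integral multiples of $t$, and $\#\mathcal{H}_t(\lambda)$ is its cardinality with multiplicity. $\lambda^*$ denotes the conjugate partition (reflection in the principal diagonal $\{(i,i)\}$). $D(\lambda)$ is the side length of the largest square contained in the Ferrers diagram, and $\delta_\lambda=(-1)^{D(\lambda)}$.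 With $a_i=\lambda_i-i$ and $b_i=\lambda^*_i-i$ for $1\le i\le D(\lambda)$, $\lambda$ is self-conjugate if $a_i=b_i$ for all $i$ (equivalently $\lambda=\lambda^*$), and doubled distinct if $a_i=b_i+1$ for all $i\in\{1,\ldots,D(\lambda)\}$; $SC$ and $DD$ are the corresponding sets of partitions. For the hook length $h$ of a box $v=(j,k)$, $\varepsilon_h=-1$ if $v$ is strictly above the principal diagonal (i.e. $j>k$), and $\varepsilon_h=1$ otherwise; thus $\varepsilon_h$ depends on the box, and a product over $h\in\mathcal{H}_t(\lambda)$ means a product over all boxes of $\lambda$ whose hook length is a multiple of $t$. *)

theory Defs
  imports
    "HOL-Library.Multiset"
    "HOL-Computational_Algebra.Formal_Power_Series"
begin

definition integer_partition :: "nat list \<Rightarrow> bool" where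
  "integer_partition \<mu> \<longleftrightarrow> sorted_wrt (\<ge>) \<mu> \<and> (\<forall>p\<in>set \<mu>. 0 < p)"

abbreviation weight :: "nat list \<Rightarrow> nat" where
  "weight \<mu> \<equiv> sum_list \<mu>"

text \<open>Parts are numbered from 1, and parts beyond the length are 0.\<close>

definition part :: "nat list \<Rightarrow> nat \<Rightarrow> nat" where
  "part \<mu> i = (if 1 \<le> i \<and> i \<le> length \<mu> then \<mu> ! (i - 1) else 0)"

text \<open>Boxes are pairs (row, column), both numbered from 1, with row 1 at the bottom
  (French convention), so that \<open>above\<close> means \<open>larger row index\<close>.\<close>

definition ferrers :: "nat list \<Rightarrow> (nat \<times> nat) set" where
  "ferrers \<mu> = {(j, k). 1 \<le> j \<and> j \<le> length \<mu> \<and> 1 \<le> k \<and> k \<le> part \<mu> j}"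

definition hook :: "nat list \<Rightarrow> nat \<times> nat \<Rightarrow> (nat \<times> nat) set" where
  "hook \<mu> v = {w \<in> ferrers \<mu>.
     (fst w = fst v \<and> snd w \<ge> snd v) \<or> (snd w = snd v \<and> fst w \<ge> fst v)}"

definition hook_length :: "nat list \<Rightarrow> nat \<times> nat \<Rightarrow> nat" where
  "hook_length \<mu> v = card (hook \<mu> v)"

definition hook_boxes :: "nat \<Rightarrow> nat list \<Rightarrow> (nat \<times> nat) set" where
  "hook_boxes t \<mu> = {v \<in> ferrers \<mu>. t dvd hook_length \<mu> v}"

definition hook_mset :: "nat \<Rightarrow> nat list \<Rightarrow> nat multiset" where
  "hook_mset t \<mu> = image_mset (hook_length \<mu>) (mset_set (hook_boxes t \<mu>))"

text \<open>The \<open>k\<close>-th part of the conjugate is the size of column \<open>k\<close>; see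
  \<open>ferrers_conj_partition\<close> below for the reflection property.\<close>

definition conj_partition :: "nat list \<Rightarrow> nat list" where
  "conj_partition \<mu> = map (\<lambda>k. card {j. (j, k) \<in> ferrers \<mu>}) [1..<Suc (part \<mu> 1)]"

definition durfee :: "nat list \<Rightarrow> nat" where
  "durfee \<mu> = Max {d. {1..d} \<times> {1..d} \<subseteq> ferrers \<mu>}"

definition delta :: "nat list \<Rightarrow> rat" where
  "delta \<mu> = (-1) ^ durfee \<mu>"

definition arm_coord :: "nat list \<Rightarrow> nat \<Rightarrow> int" where
  "arm_coord \<mu> i = int (part \<mu> i) - int i"

definition leg_coord :: "nat list \<Rightarrow> nat \<Rightarrow> int" where
  "leg_coord \<mu> i = int (part (conj_partition \<mu>) i) - int i"

definition SC :: "nat list set" where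
  "SC = {\<mu>. integer_partition \<mu> \<and> (\<forall>i\<in>{1..durfee \<mu>}. arm_coord \<mu> i = leg_coord \<mu> i)}"

definition DD :: "nat list set" where
  "DD = {\<mu>. integer_partition \<mu> \<and> (\<forall>i\<in>{1..durfee \<mu>}. arm_coord \<mu> i = leg_coord \<mu> i + 1)}"

text \<open>The sign depends on the box, not only on its hook length.\<close>

definition box_sign :: "nat \<times> nat \<Rightarrow> rat" where
  "box_sign v = (if fst v > snd v then -1 else 1)"

definition signed_hook_prod :: "nat \<Rightarrow> nat list \<Rightarrow> rat" where
  "signed_hook_prod t \<mu> =
     (\<Prod>v\<in>hook_boxes t \<mu>. of_nat t / (of_nat (hook_length \<mu> v) * box_sign v))"

lemma finite_ferrers: "finite (ferrers \<mu>)"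
proof (rule finite_subset)
  show "ferrers \<mu> \<subseteq> (\<Union>j\<in>{1..length \<mu>}. {j} \<times> {1..part \<mu> j})"
    by (auto simp: ferrers_def)
qed auto

lemma ferrers_down_closed:
  assumes "integer_partition \<mu>" "(j, k) \<in> ferrers \<mu>" "1 \<le> i" "i \<le> j" "1 \<le> l" "l \<le> k"
  shows "(i, l) \<in> ferrers \<mu>"
proof -
  have "part \<mu> j \<le> part \<mu> i"
    using assms unfolding integer_partition_def ferrers_def part_def
    by (cases "i = j") (auto simp: sorted_wrt_iff_nth_less)
  thus ?thesis using assms by (auto simp: ferrers_def)
qed

lemma ferrers_conj_partition:
  assumes "integer_partition \<mu>"
  shows "ferrers (conj_partition \<mu>) = prod.swap ` ferrers \<mu>"
proof -
  let ?c = "\<lambda>k. card {j. (j, k) \<in> ferrers \<mu>}"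
  have col: "(j, k) \<in> ferrers \<mu> \<longleftrightarrow> 1 \<le> j \<and> j \<le> ?c k" for j k
  proof
    assume a: "(j, k) \<in> ferrers \<mu>"
    hence "{1..j} \<subseteq> {j. (j, k) \<in> ferrers \<mu>}"
      using ferrers_down_closed[OF assms a] by (auto simp: ferrers_def)
    moreover have "finite {j. (j, k) \<in> ferrers \<mu>}"
      by (rule finite_subset[of _ "fst ` ferrers \<mu>"]) (force simp: finite_ferrers)+
    ultimately have "card {1..j} \<le> ?c k" by (rule card_mono[rotated])
    thus "1 \<le> j \<and> j \<le> ?c k" using a by (auto simp: ferrers_def)
  next
    assume a: "1 \<le> j \<and> j \<le> ?c k"
    show "(j, k) \<in> ferrers \<mu>"
    proof (rule ccontr)
      assume n: "(j, k) \<notin> ferrers \<mu>"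
      have "{i. (i, k) \<in> ferrers \<mu>} \<subseteq> {1..<j}"
      proof
        fix i assume "i \<in> {i. (i, k) \<in> ferrers \<mu>}"
        hence i: "(i, k) \<in> ferrers \<mu>" by simp
        hence "\<not> j \<le> i"
          using ferrers_down_closed[OF assms i, of j k] n a by (auto simp: ferrers_def)
        thus "i \<in> {1..<j}" using i by (auto simp: ferrers_def)
      qed
      hence "?c k \<le> card {1..<j}" by (rule card_mono[rotated]) simp
      thus False using a by (simp, linarith)
    qed
  qed
  have row1: "k \<le> part \<mu> 1 \<and> 1 \<le> k" if "(j, k) \<in> ferrers \<mu>" for j k
    using ferrers_down_closed[OF assms that, of 1 k] that by (auto simp: ferrers_def)
  have "(k, j) \<in> ferrers (conj_partition \<mu>) \<longleftrightarrow> (j, k) \<in> ferrers \<mu>" for j k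
  proof -
    have "(k, j) \<in> ferrers (conj_partition \<mu>) \<longleftrightarrow>
            1 \<le> k \<and> k \<le> part \<mu> 1 \<and> 1 \<le> j \<and> j \<le> ?c k"
      unfolding ferrers_def[of "conj_partition \<mu>"] part_def[of "conj_partition \<mu>"]
      by (auto simp: conj_partition_def simp del: upt_Suc)
    thus ?thesis using col[of j k] row1[of j k] by blast
  qed
  thus ?thesis by force
qed

end

(*
A partition is encoded by its set of beads lambda_j - j. Boxes are pairs (bead, smaller hole), and
removing a t-ribbon slides a bead down by t. Let P be the product of t/h over the hooks divisible by
t, and N their number. The partial fraction expansion of prod (1 - c/(w - y)) over the beads y of
one residue class, with c = t and c = -t, shows that P, summed over all removals of a ribbon, gives
N P, and summed over all additions, gives t P.

Self-conjugate and doubled distinct partitions are the bead sets symmetric under x -> -e - x with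
e = 1 and e = 0. Let C_j be the signed sum of P over the symmetric sets of weight tj with N = j.
Expand j C_j over removals and t C_(j-2) over additions. A removal at x followed by the reflected
removal leads to another symmetric set, of opposite sign; undoing the second step is an addition
with the same intermediate set, so these terms cancel. What remains are the removals and additions
for which the intermediate set is itself symmetric, which is again of opposite sign. Each symmetric
set with N = j - 1 arises exactly once in this way, so j C_j + t C_(j-2) = -C_(j-1), which is the
recurrence for the coefficients of exp(-y - t y^2 / 2).
*)
theory Submission
  imports Defs
begin

text \<open>Hooks divisible by \<open>t\<close> join positions of one residue class, so one class
  can be treated at a time, cut off at an \<open>L\<close> below which all positions are beads.
  Across a removal at x the weight is multiplied by (x - L) / t times a partial fraction coefficient
  for c = t. This expression vanishes by itself when x - t is a bead, so the sum over removable
  beads is a full first moment, fixed by the expansion at infinity. For additions the sum is the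
  value of the other product at one of its zeros. Weight tj with N = j means that the
  \<open>t\<close>-core is empty. All moves preserve this, so the C_j close up under the recurrence.
  The obstacle is the sign: the box signs change irregularly under a slide. Reflection pairs almost
  all boxes, so twice the exponent of the sign is N plus a sum of local defects over the nonnegative
  beads, and comparing signs becomes a congruence modulo 4. A single removal keeps the symmetry only
  if a bead moves to its own reflection, that is 2x + e = t. Hence e and t have the same parity,
  which is why even t goes with DD and odd t with SC.\<close>

section \<open>Partial fractions\<close>

text \<open>The residues of \<open>\<Prod>y\<in>Z. 1 - c / (w - y)\<close>, as a function of \<open>w\<close>, divided by \<open>- c\<close>.\<close>

definition pf_coeff :: "rat \<Rightarrow> rat set \<Rightarrow> rat \<Rightarrow> rat" where
  "pf_coeff c Z z = (\<Prod>y\<in>Z - {z}. 1 - c / (z - y))"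

lemma pf_coeff_insert:
  assumes "finite Z" "w \<notin> Z" "z \<in> Z"
  shows "pf_coeff c (insert w Z) z = pf_coeff c Z z * (1 - c / (z - w))"
proof -
  have "insert w Z - {z} = insert w (Z - {z})" using assms by auto
  then show ?thesis using assms by (simp add: pf_coeff_def mult.commute)
qed

lemma pf_coeff_insert_self:
  assumes "w \<notin> Z"
  shows "pf_coeff c (insert w Z) w = (\<Prod>y\<in>Z. 1 - c / (w - y))"
  using assms by (simp add: pf_coeff_def)

text \<open>Induction on the poles. When \<open>v\<close> is added, the induction hypothesis at
  \<open>v\<close> itself evaluates the coefficient of the new pole, hence the arbitrary
  \<open>w\<close>; the old terms are split between the poles \<open>v\<close> and
  \<open>z\<close>.\<close>

lemma partial_fractions:
  assumes "finite Z" "w \<notin> Z"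
  shows "(\<Prod>y\<in>Z. 1 - c / (w - y)) = 1 - c * (\<Sum>z\<in>Z. pf_coeff c Z z / (w - z))"
  using assms
proof (induction Z arbitrary: w rule: finite_induct)
  case (insert v Z)
  let ?A = "pf_coeff c Z"
  let ?S = "\<lambda>w. \<Sum>z\<in>Z. ?A z / (w - z)"
  have neq: "w - v \<noteq> 0" using insert by auto
  have split: "?A z * (1 - c / (z - v)) / (w - z)
      = ?A z / (w - z) - c / (w - v) * (?A z / (w - z) - ?A z / (v - z))"
    if "z \<in> Z" for z
  proof -
    have "w - z \<noteq> 0" "v - z \<noteq> 0" "z - v \<noteq> 0" using insert that by auto
    then show ?thesis using neq
      by (simp add: divide_simps) (simp add: algebra_simps)
  qed
  have "(\<Sum>z\<in>Z. pf_coeff c (insert v Z) z / (w - z))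
      = (\<Sum>z\<in>Z. ?A z / (w - z) - c / (w - v) * (?A z / (w - z) - ?A z / (v - z)))"
  proof (rule sum.cong[OF refl])
    fix z assume z: "z \<in> Z"
    show "pf_coeff c (insert v Z) z / (w - z)
        = ?A z / (w - z) - c / (w - v) * (?A z / (w - z) - ?A z / (v - z))"
      by (simp only: pf_coeff_insert[OF insert(1,2) z] split[OF z])
  qed
  also have "\<dots> = ?S w - c / (w - v) * (?S w - ?S v)"
    by (simp only: sum_subtractf sum_distrib_left[symmetric])
  finally have rest: "(\<Sum>z\<in>Z. pf_coeff c (insert v Z) z / (w - z))
      = ?S w - c / (w - v) * (?S w - ?S v)" .
  have self: "pf_coeff c (insert v Z) v = 1 - c * ?S v"
    using insert by (simp add: pf_coeff_insert_self)
  have "(\<Prod>y\<in>insert v Z. 1 - c / (w - y)) = (1 - c / (w - v)) * (1 - c * ?S w)"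
    using insert by simp
  also have "\<dots> = 1 - c * ((1 - c * ?S v) / (w - v) + (?S w - c / (w - v) * (?S w - ?S v)))"
    using neq by (simp add: divide_simps) (simp add: algebra_simps)
  also have "\<dots> = 1 - c * (\<Sum>z\<in>insert v Z. pf_coeff c (insert v Z) z / (w - z))"
    using insert by (simp add: self rest)
  finally show ?case .
qed simp

text \<open>Up to the factor -c these are the coefficients of 1/w and 1/w^2 of the product at
  infinity. The induction avoids that expansion: the sum of \<open>pf_coeff c Z z / (w - z)\<close>
  enters with opposite signs through the new pole and through the old ones.\<close>

lemma sum_pf_coeff:
  assumes "finite Z"
  shows "(\<Sum>z\<in>Z. pf_coeff c Z z) = of_nat (card Z)"
    and "(\<Sum>z\<in>Z. z * pf_coeff c Z z) = \<Sum>Z - c * of_nat (card Z choose 2)"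
  using assms
proof (induction Z rule: finite_induct)
  case (insert w Z)
  let ?A = "pf_coeff c Z"
  have self: "pf_coeff c (insert w Z) w = 1 - c * (\<Sum>z\<in>Z. ?A z / (w - z))"
    using insert by (simp add: pf_coeff_insert_self partial_fractions)
  have "pf_coeff c (insert w Z) z = ?A z + c * (?A z / (w - z))"
    and "z * pf_coeff c (insert w Z) z = z * ?A z - c * ?A z + w * (c * (?A z / (w - z)))"
    if "z \<in> Z" for z
  proof -
    have "w - z \<noteq> 0" "z - w \<noteq> 0" using insert that by auto
    then show "pf_coeff c (insert w Z) z = ?A z + c * (?A z / (w - z))"
      and "z * pf_coeff c (insert w Z) z = z * ?A z - c * ?A z + w * (c * (?A z / (w - z)))"
      unfolding pf_coeff_insert[OF insert(1,2) that]
      by (simp_all add: divide_simps) (simp_all add: algebra_simps)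
  qed
  then have rest: "(\<Sum>z\<in>Z. pf_coeff c (insert w Z) z)
        = (\<Sum>z\<in>Z. ?A z) + c * (\<Sum>z\<in>Z. ?A z / (w - z))"
    "(\<Sum>z\<in>Z. z * pf_coeff c (insert w Z) z)
        = (\<Sum>z\<in>Z. z * ?A z) - c * (\<Sum>z\<in>Z. ?A z) + w * (c * (\<Sum>z\<in>Z. ?A z / (w - z)))"
    by (simp_all add: sum.distrib sum_subtractf sum_distrib_left)
  {
    case 1 show ?case using insert by (simp add: self rest)
  next
    case 2
    have "Suc (card Z) choose 2 = card Z + (card Z choose 2)"
      by (simp add: numeral_2_eq_2)
    with insert show ?case by (simp add: self rest algebra_simps)
  }
qed simp_all

section \<open>Sliding beads\<close>

text \<open>A Maya diagram of arbitrary charge. The charge is left free because slides preserve it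
  and mirror symmetry forces it to be 0.\<close>

definition maya :: "int set \<Rightarrow> bool" where
  "maya S \<longleftrightarrow> (\<exists>L H. {..<L} \<subseteq> S \<and> S \<subseteq> {..<H})"

text \<open>A box of a partition is a pair of a bead \<open>a\<close> and a hole \<open>b < a\<close>, with hook length \<open>a - b\<close>.\<close>

definition hooks :: "nat \<Rightarrow> int set \<Rightarrow> (int \<times> int) set" where
  "hooks t S = {(a, b). a \<in> S \<and> b \<notin> S \<and> b < a \<and> int t dvd a - b}"

definition hook_weight :: "nat \<Rightarrow> int set \<Rightarrow> rat" where
  "hook_weight t S = (\<Prod>(a, b)\<in>hooks t S. of_nat t / of_int (a - b))"

definition slide :: "int set \<Rightarrow> int \<Rightarrow> int \<Rightarrow> int set" where
  "slide S x y = insert y (S - {x})"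

text \<open>One runner of the abacus, made finite: \<open>L\<close> fixes both the residue class and
  a cut-off, in use taken so low that every position below it is a bead.\<close>

definition runner :: "nat \<Rightarrow> int \<Rightarrow> int set \<Rightarrow> int set" where
  "runner t L S = {x \<in> S. L \<le> x \<and> int t dvd x - L}"

lemma slide_slide: "x \<in> S \<Longrightarrow> y \<notin> S \<Longrightarrow> slide (slide S x y) y x = S"
  by (auto simp: slide_def)

lemma maya_lower:
  assumes "maya S"
  obtains L where "{..<L} \<subseteq> S"
  using assms by (auto simp: maya_def)

lemma maya_slide:
  assumes "maya S"
  shows "maya (slide S x y)"
proof -
  obtain L H where "{..<L} \<subseteq> S" "S \<subseteq> {..<H}" using assms by (auto simp: maya_def)
  then have "{..<min L x} \<subseteq> slide S x y" "slide S x y \<subseteq> {..<max H (y + 1)}"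
    by (auto simp: slide_def)
  then show ?thesis unfolding maya_def by blast
qed

lemma finite_maya_Ici:
  assumes "maya S"
  shows "finite {x \<in> S. L \<le> x}"
proof -
  obtain H where "S \<subseteq> {..<H}" using assms by (auto simp: maya_def)
  then have "{x \<in> S. L \<le> x} \<subseteq> {L..<H}" by auto
  then show ?thesis by (rule finite_subset) simp
qed

lemma finite_runner: "maya S \<Longrightarrow> finite (runner t L S)"
  by (rule finite_subset[OF _ finite_maya_Ici[of S L]]) (auto simp: runner_def)

lemma finite_hooks:
  assumes "maya S"
  shows "finite (hooks t S)"
proof -
  obtain L H where "{..<L} \<subseteq> S" "S \<subseteq> {..<H}" using assms by (auto simp: maya_def)
  then have *: "L \<le> b" "a < H" if "a \<in> S" "b \<notin> S" for a b
    using that by (auto simp: subset_iff not_less[symmetric])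
  have "hooks t S \<subseteq> {L..H} \<times> {L..H}"
    unfolding hooks_def using * by fastforce
  then show ?thesis by (rule finite_subset) simp
qed

lemma finite_removable:
  assumes "maya S"
  shows "finite {x \<in> S. x - c \<notin> S}"
proof -
  obtain L H where "{..<L} \<subseteq> S" "S \<subseteq> {..<H}" using assms by (auto simp: maya_def)
  then have "{x \<in> S. x - c \<notin> S} \<subseteq> {L + c..H}" by (force simp: subset_iff not_less[symmetric])
  then show ?thesis by (rule finite_subset) simp
qed

section \<open>Effect of a single ribbon removal on hooks and weight\<close>

locale ribbon_removal =
  fixes t :: nat and S :: "int set" and x u :: int
  assumes maya: "maya S" and t: "t > 0" and x: "x \<in> S" and u: "u \<notin> S" and xu: "x - u = int t"
begin

text \<open>The hook \<open>(x, u)\<close> disappears. Of the others, \<open>(x, b)\<close> becomes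
  \<open>(u, b)\<close> and \<open>(a, u)\<close> becomes \<open>(a, x)\<close>, while
  \<open>kept\<close> is untouched.\<close>

definition "kept = {(a, b) \<in> hooks t S. a \<noteq> x \<and> b \<noteq> u}"
definition "lower_holes = {b. b \<notin> S \<and> b < u \<and> int t dvd u - b}"
definition "upper_beads = {a \<in> S. x < a \<and> int t dvd a - x}"

lemma hooks_eq: "hooks t S = insert (x, u) (kept \<union> Pair x ` lower_holes \<union> (\<lambda>a. (a, u)) ` upper_beads)"
proof (intro equalityI subsetI)
  fix p assume "p \<in> hooks t S"
  then obtain a b where p: "p = (a, b)" "a \<in> S" "b \<notin> S" "b < a" "int t dvd a - b"
    by (auto simp: hooks_def)
  \<comment> \<open>A hole below \<open>x\<close> in its class is at distance at least
    \<open>t\<close>, so any such hole other than \<open>u\<close> lies below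
    \<open>u\<close>.\<close>
  have 1: "b \<in> lower_holes" if "a = x" "b \<noteq> u"
  proof -
    have "int t \<le> x - b" using p that by (intro zdvd_imp_le) auto
    moreover have "a - b = (u - b) + int t" using that xu by simp
    then have "int t dvd u - b" using p(5) by (metis dvd_add_triv_right_iff)
    ultimately show ?thesis using p that xu by (auto simp: lower_holes_def)
  qed
  have 2: "a \<in> upper_beads" if "b = u" "a \<noteq> x"
  proof -
    have "int t \<le> a - u" using p that by (intro zdvd_imp_le) auto
    moreover have "a - b = (a - x) + int t" using that xu by simp
    then have "int t dvd a - x" using p(5) by (metis dvd_add_triv_right_iff)
    ultimately show ?thesis using p that xu by (auto simp: upper_beads_def)
  qed
  show "p \<in> insert (x, u) (kept \<union> Pair x ` lower_holes \<union> (\<lambda>a. (a, u)) ` upper_beads)"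
    using 1 2 p by (auto simp: kept_def hooks_def)
next
  fix p assume "p \<in> insert (x, u) (kept \<union> Pair x ` lower_holes \<union> (\<lambda>a. (a, u)) ` upper_beads)"
  moreover have "int t dvd x - b" if "int t dvd u - b" for b
  proof -
    have "x - b = (u - b) + int t" using xu by simp
    then show ?thesis using that by (metis dvd_add_triv_right_iff)
  qed
  moreover have "int t dvd a - u" if "int t dvd a - x" for a
  proof -
    have "a - u = (a - x) + int t" using xu by simp
    then show ?thesis using that by (metis dvd_add_triv_right_iff)
  qed
  ultimately show "p \<in> hooks t S"
    using x u xu t by (auto simp: kept_def lower_holes_def upper_beads_def hooks_def)
qed

lemma hooks_slide_eq: "hooks t (slide S x u) = kept \<union> Pair u ` lower_holes \<union> (\<lambda>a. (a, x)) ` upper_beads"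
  using x u xu t
  by (auto simp: kept_def lower_holes_def upper_beads_def hooks_def slide_def)

lemma finite_parts: "finite kept" "finite lower_holes" "finite upper_beads"
proof -
  have "finite (hooks t S)" using maya by (rule finite_hooks)
  then have "finite (kept \<union> Pair x ` lower_holes \<union> (\<lambda>a. (a, u)) ` upper_beads)"
    unfolding hooks_eq by simp
  then show "finite kept" "finite lower_holes" "finite upper_beads"
    by (auto dest!: finite_imageD simp: inj_on_def)
qed

lemma disjoint_parts:
  "(x, u) \<notin> kept \<union> Pair x ` lower_holes \<union> (\<lambda>a. (a, u)) ` upper_beads"
  "kept \<inter> Pair x ` lower_holes = {}" "(kept \<union> Pair x ` lower_holes) \<inter> (\<lambda>a. (a, u)) ` upper_beads = {}"
  "kept \<inter> Pair u ` lower_holes = {}" "(kept \<union> Pair u ` lower_holes) \<inter> (\<lambda>a. (a, x)) ` upper_beads = {}"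
  using x u xu t by (auto simp: kept_def lower_holes_def upper_beads_def hooks_def)

lemma card_hooks_slide: "card (hooks t S) = Suc (card (hooks t (slide S x u)))"
  unfolding hooks_eq hooks_slide_eq using disjoint_parts finite_parts
  by (simp add: card_Un_disjoint card_image inj_on_def)

lemma prod_hooks:
  fixes f :: "int \<times> int \<Rightarrow> 'a::comm_monoid_mult"
  shows "prod f (hooks t S)
      = f (x, u) * (prod f kept * (\<Prod>b\<in>lower_holes. f (x, b)) * (\<Prod>a\<in>upper_beads. f (a, u)))"
    and "prod f (hooks t (slide S x u))
      = prod f kept * (\<Prod>b\<in>lower_holes. f (u, b)) * (\<Prod>a\<in>upper_beads. f (a, x))"
proof -
  have reindex: "prod f (Pair v ` A) = (\<Prod>b\<in>A. f (v, b))"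
      "prod f ((\<lambda>a. (a, v)) ` A) = (\<Prod>a\<in>A. f (a, v))" for v A
    by (subst prod.reindex; simp add: inj_on_def)+
  show "prod f (hooks t S)
      = f (x, u) * (prod f kept * (\<Prod>b\<in>lower_holes. f (x, b)) * (\<Prod>a\<in>upper_beads. f (a, u)))"
    unfolding hooks_eq using disjoint_parts finite_parts
    by (simp add: prod.union_disjoint reindex)
  show "prod f (hooks t (slide S x u))
      = prod f kept * (\<Prod>b\<in>lower_holes. f (u, b)) * (\<Prod>a\<in>upper_beads. f (a, x))"
    unfolding hooks_slide_eq using disjoint_parts finite_parts
    by (simp add: prod.union_disjoint reindex)
qed

end

lemma prod_shift_ratio:
  \<comment> \<open>Telescopes. It evaluates the product of (u - b) / (x - b) over all positions b
    of the class from \<open>L\<close> up to below \<open>u\<close>, beads and holes alike.\<close>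
  "(\<Prod>i<K. (of_nat (K - i) :: rat) / of_nat (K + 1 - i)) = 1 / of_nat (K + 1)"
proof (induction K)
  case (Suc K)
  have "(\<Prod>i<Suc K. (of_nat (Suc K - i) :: rat) / of_nat (Suc K + 1 - i))
      = of_nat (Suc K) / of_nat (Suc K + 1) * (\<Prod>i<K. of_nat (K - i) / of_nat (K + 1 - i))"
    by (subst prod.lessThan_Suc_shift) simp
  then show ?case using Suc by (simp add: field_simps)
qed simp

lemma runner_interval:
  fixes L x :: int and t K :: nat
  assumes "t > 0" "x = L + int t * int K"
  shows "bij_betw (\<lambda>i. L + int t * int i) {..<K} {b. L \<le> b \<and> b < x \<and> int t dvd b - L}"
proof (rule bij_betwI')
  fix b assume b: "b \<in> {b. L \<le> b \<and> b < x \<and> int t dvd b - L}"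
  then obtain k where k: "b - L = int t * k" by (auto simp: dvd_def)
  with b assms have "0 \<le> k" "int t * k < int t * int K"
    by (auto simp: zero_le_mult_iff algebra_simps)
  with assms k show "\<exists>i\<in>{..<K}. b = L + int t * int i"
    by (intro bexI[of _ "nat k"]) (auto simp: nat_less_iff)
qed (use assms in \<open>auto\<close>)

context ribbon_removal
begin

text \<open>The quotient of the weights involves the holes below \<open>u\<close> and the beads
  above \<open>x\<close>. The telescoping product over all positions below \<open>u\<close> trades
  those holes for the beads below \<open>u\<close>, at the cost of the factor (x - L) / t. What is
  left is a product over beads only, as partial fractions require.\<close>

lemma hook_weight_slide:
  assumes L: "{..<L} \<subseteq> S" "int t dvd x - L"
  shows "hook_weight t (slide S x u) = hook_weight t S * (of_int (x - L) / of_nat t)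
           * (\<Prod>b\<in>runner t L S - {x}. 1 - of_nat t / (of_int x - of_int b))"
proof -
  have x_eq: "x = u + int t" using xu by simp
  let ?F = "\<lambda>b. (of_int (u - b) / of_int (x - b) :: rat)"
  have uL: "L \<le> u" using u L by (auto simp: subset_iff not_less[symmetric])
  have tuL: "int t dvd u - L"
  proof -
    have "x - L = (u - L) + int t" using xu by simp
    then show ?thesis using L(2) by (metis dvd_add_triv_right_iff)
  qed
  define K where "K = nat ((u - L) div int t)"
  have uK: "u = L + int t * int K" using uL tuL t by (auto simp: K_def pos_imp_zdiv_nonneg_iff)
  define Rb where "Rb = {b \<in> runner t L S. b < u}"
  have fin: "finite Rb" unfolding Rb_def using finite_runner[OF maya] by simp
  have cong_iff: "int t dvd u - b \<longleftrightarrow> int t dvd b - L" for b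
  proof -
    have "u - L = (u - b) + (b - L)" by simp
    then show ?thesis using tuL dvd_add_left_iff dvd_add_right_iff by metis
  qed
  have all: "{b. L \<le> b \<and> b < u \<and> int t dvd b - L} = Rb \<union> lower_holes" "Rb \<inter> lower_holes = {}"
    using L u by (auto simp: Rb_def runner_def lower_holes_def cong_iff not_less[symmetric])
  have "prod ?F (Rb \<union> lower_holes) = (\<Prod>i<K. ?F (L + int t * int i))"
    using runner_interval[OF t uK] unfolding all(1)
    by (rule prod.reindex_bij_betw[symmetric])
  also have "\<dots> = (\<Prod>i<K. (of_nat (K - i) :: rat) / of_nat (K + 1 - i))"
  proof (rule prod.cong[OF refl])
    fix i assume "i \<in> {..<K}"
    then have "u - (L + int t * int i) = int t * int (K - i)"
      "x - (L + int t * int i) = int t * int (K + 1 - i)"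
      unfolding x_eq uK by (auto simp: of_nat_diff algebra_simps)
    then show "?F (L + int t * int i) = of_nat (K - i) / of_nat (K + 1 - i)"
      using t by simp
  qed
  also have "\<dots> = of_nat t / of_int (x - L)"
  proof -
    have "x - L = int t * int (K + 1)" unfolding x_eq uK by (simp add: algebra_simps)
    then have "of_int (x - L) = (of_nat t * of_nat (K + 1) :: rat)" by (simp only: of_int_mult of_int_of_nat_eq)
    then show ?thesis unfolding prod_shift_ratio using t by (simp del: of_nat_Suc add: Suc_eq_plus1[symmetric])
  qed
  finally have RB: "prod ?F Rb * prod ?F lower_holes = of_nat t / of_int (x - L)"
    using all(2) fin finite_parts by (simp add: prod.union_disjoint)
  have cong_iff2: "int t dvd a - x \<longleftrightarrow> int t dvd a - L" for a
  proof -
    have "a - L = (a - x) + (x - L)" by simp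
    then show ?thesis using dvd_add_left_iff[OF L(2)] by metis
  qed
  have "runner t L S - {x} = Rb \<union> upper_beads" 
  proof (intro equalityI subsetI)
    fix b assume b: "b \<in> runner t L S - {x}"
    show "b \<in> Rb \<union> upper_beads"
    proof (cases "b < x")
      case True
      have "int t dvd u - b" using b cong_iff by (auto simp: runner_def)
      moreover have "x - b = (u - b) + int t" using xu by simp
      ultimately have "int t dvd x - b" by (metis dvd_add_triv_right_iff)
      then have "int t \<le> x - b" using True by (intro zdvd_imp_le) auto
      then have "b \<le> u" using xu by simp
      moreover have "b \<noteq> u" using b u by (auto simp: runner_def)
      ultimately show ?thesis using b by (auto simp: Rb_def)
    qed (use b cong_iff2 in \<open>auto simp: upper_beads_def runner_def\<close>)
  qed (use uL xu t cong_iff2 in \<open>auto simp: Rb_def upper_beads_def runner_def\<close>)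
  moreover have "Rb \<inter> upper_beads = {}" using xu t by (auto simp: Rb_def upper_beads_def)
  moreover have "1 - of_nat t / (of_int x - of_int b) = ?F b" if "b \<noteq> x" for b
    using that xu by (auto simp: field_simps)
  moreover from this have "(\<Prod>b\<in>runner t L S - {x}. 1 - of_nat t / (of_int x - of_int b))
      = prod ?F (runner t L S - {x})" by (intro prod.cong) auto
  ultimately have "(\<Prod>b\<in>runner t L S - {x}. 1 - of_nat t / (of_int x - of_int b))
      = prod ?F Rb * prod ?F upper_beads"
    using fin finite_parts by (simp add: prod.union_disjoint)
  then have "of_int (x - L) / of_nat t * (\<Prod>b\<in>runner t L S - {x}. 1 - of_nat t / (of_int x - of_int b)) 
      * prod ?F lower_holes = of_int (x - L) / of_nat t * (prod ?F Rb * prod ?F lower_holes) * prod ?F upper_beads"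
    by simp
  also have "\<dots> = prod ?F upper_beads" unfolding RB using t uL xu by simp
  finally have ratio: "of_int (x - L) / of_nat t
      * (\<Prod>b\<in>runner t L S - {x}. 1 - of_nat t / (of_int x - of_int b)) * prod ?F lower_holes = prod ?F upper_beads" 
      (is "?Q * _ = _") .
  have nz: "prod ?F lower_holes \<noteq> 0" using finite_parts xu by (auto simp: lower_holes_def)
  let ?w = "\<lambda>(a, b). of_nat t / (of_int (a - b) :: rat)"
  have b1: "(\<Prod>b\<in>lower_holes. ?w (x, b)) = (\<Prod>b\<in>lower_holes. ?w (u, b)) * prod ?F lower_holes"
    unfolding prod.distrib[symmetric] using xu by (intro prod.cong) (auto simp: lower_holes_def)
  have a1: "(\<Prod>a\<in>upper_beads. ?w (a, x)) = (\<Prod>a\<in>upper_beads. ?w (a, u)) * prod ?F upper_beads"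
    unfolding prod.distrib[symmetric] using xu t
    by (intro prod.cong) (auto simp: upper_beads_def divide_simps, (simp add: algebra_simps)?)
  have "?w (x, u) = 1" using xu t by simp
  then show ?thesis
    unfolding hook_weight_def prod_hooks mult.assoc[of _ "of_int (x - L) / of_nat t"]
    unfolding b1 a1 ratio[symmetric] by (simp add: mult_ac)
qed

end

section \<open>Sums over removals and additions of a ribbon\<close>

lemma pf_coeff_of_int:
  "pf_coeff c (of_int ` R) (of_int x) = (\<Prod>b\<in>R - {x}. 1 - c / (of_int x - of_int b))"
proof -
  have "of_int ` R - {of_int x :: rat} = of_int ` (R - {x})" by auto
  then show ?thesis unfolding pf_coeff_def by (simp add: prod.reindex inj_on_def)
qed

lemma sum_pf_coeff_of_int:
  fixes R :: "int set"
  assumes "finite R"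
  shows "(\<Sum>x\<in>R. \<Prod>b\<in>R - {x}. 1 - c / (of_int x - of_int b)) = (of_nat (card R) :: rat)"
    and "(\<Sum>x\<in>R. of_int x * (\<Prod>b\<in>R - {x}. 1 - c / (of_int x - of_int b)))
           = (\<Sum>x\<in>R. of_int x) - (c :: rat) * of_nat (card R choose 2)"
  using sum_pf_coeff[of "of_int ` R :: rat set" c] assms
  by (simp_all add: sum.reindex inj_on_def pf_coeff_of_int card_image)

text \<open>The summand given by \<open>hook_weight_slide\<close> is zero at beads that cannot be
  moved, so the sum extends to the whole runner, where the two moments of
  \<open>sum_pf_coeff\<close> evaluate it.\<close>

lemma sum_removals_runner:
  assumes "maya S" "t > 0" "{..<L} \<subseteq> S"
  shows "(\<Sum>x | x \<in> runner t L S \<and> x - int t \<notin> S. hook_weight t (slide S x (x - int t)))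
    = hook_weight t S * ((\<Sum>x\<in>runner t L S. of_int (x - L)) / of_nat t
        - of_nat (card (runner t L S) choose 2))"
proof -
  let ?R = "runner t L S"
  let ?A = "\<lambda>x. \<Prod>b\<in>?R - {x}. 1 - of_nat t / (of_int x - of_int b) :: rat"
  have fin: "finite ?R" using assms by (intro finite_runner)
  have A: "(if x - int t \<notin> S then hook_weight t (slide S x (x - int t)) else 0)
      = hook_weight t S / of_nat t * (of_int x * ?A x - of_int L * ?A x)" if x: "x \<in> ?R" for x
  proof (cases "x - int t \<in> S")
    case False
    then interpret rib: ribbon_removal t S x "x - int t"
      using assms x by unfold_locales (auto simp: runner_def)
    show ?thesis using rib.hook_weight_slide[OF assms(3)] x False
      by (simp add: runner_def) (simp add: field_simps)
  next
    case True
    \<comment> \<open>For \<open>x = L\<close> the bead \<open>x - t\<close> lies outside the runner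
      and the product need not vanish; there the factor \<open>x - L\<close> does.\<close>
    show ?thesis
    proof (cases "x = L")
      case False
      have "L < x" "int t dvd x - L" using x False by (auto simp: runner_def)
      then have "int t \<le> x - L" by (intro zdvd_imp_le) auto
      moreover have "x - L = (x - int t - L) + int t" by simp
      then have "int t dvd x - int t - L" using \<open>int t dvd x - L\<close>
        by (metis dvd_add_triv_right_iff)
      ultimately have "x - int t \<in> ?R - {x}" using True assms(2) by (auto simp: runner_def)
      then have "?A x = 0" using fin assms(2) by (intro prod_zero) (auto intro!: bexI[of _ "x - int t"])
      then show ?thesis using True by simp
    qed (use True in simp)
  qed
  have "(\<Sum>x | x \<in> ?R \<and> x - int t \<notin> S. hook_weight t (slide S x (x - int t)))
      = (\<Sum>x\<in>?R. if x - int t \<notin> S then hook_weight t (slide S x (x - int t)) else 0)"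
    using fin by (intro sum.mono_neutral_cong_left) auto
  also have "\<dots> = hook_weight t S / of_nat t * ((\<Sum>x\<in>?R. of_int x * ?A x) - of_int L * (\<Sum>x\<in>?R. ?A x))"
    by (simp only: A sum_subtractf sum_distrib_left[symmetric] cong: sum.cong)
  also have "\<dots> = hook_weight t S / of_nat t
      * ((\<Sum>x\<in>?R. of_int x) - of_nat t * of_nat (card ?R choose 2) - of_int L * of_nat (card ?R))"
    using fin by (simp only: sum_pf_coeff_of_int)
  also have "\<dots> = hook_weight t S * ((\<Sum>x\<in>?R. of_int (x - L)) / of_nat t - of_nat (card ?R choose 2))"
    using assms(2) by (simp add: sum_subtractf field_simps)
  finally show ?thesis .
qed

text \<open>Each addition is read backwards as a removal from the enlarged set. The inverse of its
  ratio is a partial fraction coefficient for c = -t divided by (x + t - L) / t, so the sum is that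
  of the partial fractions at w = L - t.\<close>

lemma sum_additions_runner:
  assumes "maya S" "t > 0" "{..<L + int t} \<subseteq> S"
  shows "(\<Sum>x | x \<in> runner t L S \<and> x + int t \<notin> S. hook_weight t (slide S x (x + int t)))
    = hook_weight t S"
proof -
  let ?R = "runner t L S"
  let ?A = "\<lambda>x. \<Prod>b\<in>?R - {x}. 1 - (- of_nat t) / (of_int x - of_int b) :: rat"
  \<comment> \<open>The product over all beads \<open>y\<close> of \<open>1 + t / (w - y)\<close> vanishes at this \<open>w\<close>, as \<open>L\<close> is a bead.\<close>
  define w :: rat where "w = of_int (L - int t)"
  have fin: "finite ?R" using assms by (intro finite_runner)
  have L: "{..<L} \<subseteq> S" using assms(3) by auto
  have A: "(if x + int t \<notin> S then hook_weight t (slide S x (x + int t)) else 0)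
      = - (hook_weight t S * of_nat t * (?A x / (w - of_int x)))" if x: "x \<in> ?R" for x
  proof (cases "x + int t \<in> S")
    case False
    let ?S = "slide S x (x + int t)"
    have xS: "x \<in> S" "L \<le> x" using x by (auto simp: runner_def)
    interpret rib: ribbon_removal t ?S "x + int t" x
      using assms(2) maya_slide[OF assms(1)] by unfold_locales (auto simp: slide_def)
    have "{..<L} \<subseteq> ?S" using L xS by (auto simp: slide_def)
    moreover have "x + int t - L = (x - L) + int t" by simp
    then have d: "int t dvd x + int t - L" using x unfolding runner_def
      by (metis (mono_tags, lifting) dvd_add_triv_right_iff mem_Collect_eq)
    ultimately have "hook_weight t (slide ?S (x + int t) x) = hook_weight t ?S * (of_int (x + int t - L) / of_nat t)
           * (\<Prod>b\<in>runner t L ?S - {x + int t}. 1 - of_nat t / (of_int (x + int t) - of_int b))"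
      by (rule rib.hook_weight_slide)
    moreover have "slide ?S (x + int t) x = S" using xS False by (intro slide_slide)
    moreover have "runner t L ?S - {x + int t} = ?R - {x}"
      using False xS by (auto simp: runner_def slide_def)
    ultimately have down: "hook_weight t S = hook_weight t ?S * (of_int (x + int t - L) / of_nat t)
           * (\<Prod>b\<in>?R - {x}. 1 - of_nat t / (of_int (x + int t) - of_int b))" by simp
    \<comment> \<open>The two factors are (x - b) / (x + t - b) and its reciprocal.\<close>
    have inv: "(\<Prod>b\<in>?R - {x}. 1 - of_nat t / (of_int (x + int t) - of_int b)) * ?A x = 1"
      unfolding prod.distrib[symmetric]
    proof (intro prod.neutral ballI)
      fix b assume "b \<in> ?R - {x}"
      then have "b \<noteq> x + int t" "b \<noteq> x" using False by (auto simp: runner_def)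
      then have "(of_int (x + int t) - of_int b :: rat) \<noteq> 0" "(of_int x - of_int b :: rat) \<noteq> 0"
        by (auto simp flip: of_int_diff)
      then show "(1 - of_nat t / (of_int (x + int t) - of_int b))
          * (1 - - of_nat t / (of_int x - of_int b)) = (1 :: rat)"
        by (simp add: divide_simps) 
    qed
    have "w - of_int x = - of_int (x + int t - L)" by (simp add: w_def)
    moreover have "(of_int (x + int t - L) :: rat) \<noteq> 0"
      using xS assms(2) by (simp del: of_int_diff of_int_add)
    ultimately have "- (hook_weight t S * of_nat t * (?A x / (w - of_int x)))
        = hook_weight t ?S * ((\<Prod>b\<in>?R - {x}. 1 - of_nat t / (of_int (x + int t) - of_int b)) * ?A x)"
      using assms(2) by (subst down) (simp del: of_int_diff of_int_add minus_divide_left)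
    then show ?thesis using False unfolding inv by simp
  next
    case True
    have "int t dvd x + int t - L"
    proof -
      have "x + int t - L = (x - L) + int t" by simp
      then show ?thesis using x unfolding runner_def
        by (metis (mono_tags, lifting) dvd_add_triv_right_iff mem_Collect_eq)
    qed
    then have "x + int t \<in> ?R - {x}" using True x assms(2) by (auto simp: runner_def)
    then have "?A x = 0" using fin assms(2) by (intro prod_zero) (auto intro!: bexI[of _ "x + int t"])
    then show ?thesis using True by simp
  qed
  have "L \<in> ?R" using assms by (auto simp: runner_def)
  then have "(\<Prod>y\<in>of_int ` ?R. 1 - (- of_nat t) / (w - y)) = 0"
    using fin assms(2) by (intro prod_zero) (auto intro!: bexI[of _ "L"] simp: w_def)
  moreover have "w \<notin> of_int ` ?R" using assms(2) by (auto simp: w_def runner_def)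
  then have "(\<Prod>y\<in>of_int ` ?R. 1 - (- of_nat t) / (w - y))
      = 1 - (- of_nat t) * (\<Sum>z\<in>of_int ` ?R. pf_coeff (- of_nat t) (of_int ` ?R) z / (w - z))"
    using fin by (intro partial_fractions) auto
  ultimately have "0 = 1 - (- of_nat t) * (\<Sum>z\<in>of_int ` ?R. pf_coeff (- of_nat t) (of_int ` ?R) z / (w - z))"
    by (simp only:)
  then have *: "of_nat t * (\<Sum>x\<in>?R. ?A x / (w - of_int x)) = -1"
    by (simp add: sum.reindex inj_on_def pf_coeff_of_int add_eq_0_iff)
  have "(\<Sum>x | x \<in> ?R \<and> x + int t \<notin> S. hook_weight t (slide S x (x + int t)))
      = (\<Sum>x\<in>?R. if x + int t \<notin> S then hook_weight t (slide S x (x + int t)) else 0)"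
    using fin by (intro sum.mono_neutral_cong_left) auto
  also have "\<dots> = - (hook_weight t S * (of_nat t * (\<Sum>x\<in>?R. ?A x / (w - of_int x))))"
    by (simp only: A sum_negf sum_distrib_left mult.assoc cong: sum.cong)
  also have "\<dots> = hook_weight t S" unfolding * by simp
  finally show ?thesis .
qed

section \<open>Counting the hooks of one residue class\<close>

lemma card_descending_pairs:
  fixes R :: "'a::linorder set"
  assumes "finite R"
  shows "card {(a, b). a \<in> R \<and> b \<in> R \<and> b < a} = card R choose 2"
  using assms
proof (induction R rule: finite_linorder_max_induct)
  case (insert m R)
  have "{(a, b). a \<in> insert m R \<and> b \<in> insert m R \<and> b < a}
      = {(a, b). a \<in> R \<and> b \<in> R \<and> b < a} \<union> Pair m ` R"
    using insert by force
  moreover have "finite {(a, b). a \<in> R \<and> b \<in> R \<and> b < a}"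
    by (rule finite_subset[of _ "R \<times> R"]) (use insert in auto)
  moreover have "{(a, b). a \<in> R \<and> b \<in> R \<and> b < a} \<inter> Pair m ` R = {}"
    using insert by force
  moreover have "m \<notin> R" using insert by auto
  ultimately show ?case using insert
    by (simp add: card_Un_disjoint card_image inj_on_def numeral_2_eq_2)
qed simp

text \<open>A bead \<open>x\<close> has (x - L) / t positions of its class from \<open>L\<close> up
  to below \<open>x\<close>. Those that are holes give hooks, and those that are beads give the
  descending pairs counted by the binomial coefficient.\<close>

lemma card_hooks_runner:
  assumes "maya S" "t > 0" "{..<L} \<subseteq> S"
  shows "(of_nat (card {(a, b) \<in> hooks t S. int t dvd a - L}) :: rat)
    = (\<Sum>x\<in>runner t L S. of_int (x - L)) / of_nat t - of_nat (card (runner t L S) choose 2)"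
proof -
  let ?R = "runner t L S"
  let ?H = "{(a, b) \<in> hooks t S. int t dvd a - L}" and ?I = "{(a, b). a \<in> ?R \<and> b \<in> ?R \<and> b < a}"
  let ?B = "\<lambda>x. {b. L \<le> b \<and> b < x \<and> int t dvd b - L}"
  have fin: "finite ?R" using assms by (intro finite_runner)
  have residue: "int t dvd a - b \<longleftrightarrow> int t dvd b - L" if "int t dvd a - L" for a b
  proof -
    have "a - L = (a - b) + (b - L)" by simp
    then show ?thesis using that dvd_add_left_iff dvd_add_right_iff by metis
  qed
  have nS: "L \<le> b" if "b \<notin> S" for b using assms(3) that by (auto simp: subset_iff not_less[symmetric])
  have union: "?H \<union> ?I = (SIGMA x:?R. ?B x)"
  proof (intro equalityI subsetI)
    fix p assume "p \<in> ?H \<union> ?I"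
    then show "p \<in> (SIGMA x:?R. ?B x)"
      using residue by (auto simp: hooks_def runner_def dest!: nS)
  next
    fix p assume "p \<in> (SIGMA x:?R. ?B x)"
    then obtain a b where "p = (a, b)" "a \<in> ?R" "b \<in> ?B a" by auto
    then show "p \<in> ?H \<union> ?I" using residue[of a b] by (auto simp: hooks_def runner_def)
  qed
  have card_B: "(of_nat (card (?B x)) :: rat) = of_int (x - L) / of_nat t" if "x \<in> ?R" for x
  proof -
    from that obtain k where k: "x - L = int t * k" "L \<le> x" by (auto simp: runner_def dvd_def)
    then have "0 \<le> int t * k" by simp
    then have "0 \<le> k" using assms(2) by (simp add: zero_le_mult_iff)
    with k have x: "x = L + int t * int (nat k)" by simp
    have "card (?B x) = nat k"
      using bij_betw_same_card[OF runner_interval[OF assms(2) x]] by simp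
    then show ?thesis using k \<open>0 \<le> k\<close> assms(2) by simp
  qed
  have finB: "finite (?B x)" for x by (rule finite_subset[of _ "{L..x}"]) auto
  have "card ?H + card ?I = card (?H \<union> ?I)"
  proof (rule card_Un_disjoint[symmetric])
    show "finite ?H" by (rule finite_subset[OF _ finite_hooks[OF assms(1), of t]]) auto
    show "finite ?I" by (rule finite_subset[of _ "?R \<times> ?R"]) (use fin in auto)
    show "?H \<inter> ?I = {}" by (auto simp: hooks_def runner_def)
  qed
  also have "\<dots> = (\<Sum>x\<in>?R. card (?B x))" unfolding union using fin finB by simp
  finally have "(of_nat (card ?H + card ?I) :: rat) = (\<Sum>x\<in>?R. of_int (x - L) / of_nat t)"
    by (simp only: of_nat_sum card_B cong: sum.cong)
  then show ?thesis unfolding card_descending_pairs[OF fin] by (simp add: sum_divide_distrib)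
qed

lemma sum_removals:
  assumes "maya S" "t > 0"
  shows "(\<Sum>x | x \<in> S \<and> x - int t \<notin> S. hook_weight t (slide S x (x - int t)))
    = of_nat (card (hooks t S)) * hook_weight t S"
proof -
  obtain L where "{..<L} \<subseteq> S" using assms(1) by (rule maya_lower)
  then have L: "{..<L - int t + int t} \<subseteq> S" by simp
  \<comment> \<open>The starting points \<open>M + r\<close> with 0 <= r < t meet every residue once
    and stay below \<open>L\<close>, so only beads lie beneath them.\<close>
  define M where "M = L - int t"
  let ?c = "\<lambda>x. (x - M) mod int t" and ?I = "{0..<int t}"
  have lowM: "{..<M + int t} \<subseteq> S" using L by (simp add: M_def)
  then have Lr: "{..<M + r} \<subseteq> S" if "r \<in> ?I" for r using that by (auto intro: subsetD)
  have cr: "?c x = r \<longleftrightarrow> int t dvd x - (M + r)" if "r \<in> ?I" for x r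
  proof -
    have "?c x = r \<longleftrightarrow> ?c x = r mod int t" using that by simp
    then show ?thesis by (simp only: mod_eq_dvd_iff diff_diff_eq)
  qed
  have ge: "M + int t \<le> x - int t" if "x - int t \<notin> S" for x
    using lowM that by (auto simp: subset_iff not_less[symmetric])
  let ?X = "{x \<in> S. x - int t \<notin> S}"
  have finX: "finite ?X" using assms(1) by (rule finite_removable)
  have "(\<Sum>x\<in>?X. hook_weight t (slide S x (x - int t)))
      = (\<Sum>r\<in>?I. \<Sum>x\<in>{x \<in> ?X. ?c x = r}. hook_weight t (slide S x (x - int t)))"
    using finX assms(2) by (intro sum.group[symmetric]) auto
  also have "\<dots> = (\<Sum>r\<in>?I. hook_weight t S * of_nat (card {p \<in> hooks t S. ?c (fst p) = r}))"
  proof (rule sum.cong[OF refl])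
    fix r assume r: "r \<in> ?I"
    have "{x \<in> ?X. ?c x = r} = {x. x \<in> runner t (M + r) S \<and> x - int t \<notin> S}"
      unfolding cr[OF r] using ge r by (fastforce simp: runner_def)
    moreover have "{p \<in> hooks t S. ?c (fst p) = r} = {(a, b) \<in> hooks t S. int t dvd a - (M + r)}"
      unfolding cr[OF r] by auto
    ultimately show "(\<Sum>x\<in>{x \<in> ?X. ?c x = r}. hook_weight t (slide S x (x - int t)))
        = hook_weight t S * of_nat (card {p \<in> hooks t S. ?c (fst p) = r})"
      using sum_removals_runner[OF assms Lr[OF r]] card_hooks_runner[OF assms Lr[OF r]] by simp
  qed
  also have "\<dots> = hook_weight t S * of_nat (\<Sum>r\<in>?I. card {p \<in> hooks t S. ?c (fst p) = r})"
    by (simp add: sum_distrib_left)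
  also have "(\<Sum>r\<in>?I. card {p \<in> hooks t S. ?c (fst p) = r}) = card (hooks t S)"
  proof -
    have "(\<Sum>r\<in>?I. \<Sum>p\<in>{p \<in> hooks t S. ?c (fst p) = r}. 1 :: nat) = (\<Sum>p\<in>hooks t S. 1)"
      using assms(2) finite_hooks[OF assms(1)] by (intro sum.group) auto
    then show ?thesis by simp
  qed
  finally show ?thesis by (simp add: mult.commute)
qed

text \<open>Each of the \<open>t\<close> residue classes contributes one full copy of the
  weight.\<close>

lemma sum_additions:
  assumes "maya S" "t > 0"
  shows "(\<Sum>x | x \<in> S \<and> x + int t \<notin> S. hook_weight t (slide S x (x + int t)))
    = of_nat t * hook_weight t S"
proof -
  obtain L where L: "{..<L} \<subseteq> S" using assms(1) by (rule maya_lower)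
  \<comment> \<open>Twice \<open>t\<close>, because here the first position of each runner must
    itself be a bead: it provides the zero of the product.\<close>
  define M where "M = L - 2 * int t"
  let ?c = "\<lambda>x. (x - M) mod int t" and ?I = "{0..<int t}"
  have Lr: "{..<M + r + int t} \<subseteq> S" if "r \<in> ?I" for r using that L by (auto simp: M_def intro: subsetD)
  have cr: "?c x = r \<longleftrightarrow> int t dvd x - (M + r)" if "r \<in> ?I" for x r
  proof -
    have "?c x = r \<longleftrightarrow> ?c x = r mod int t" using that by simp
    then show ?thesis by (simp only: mod_eq_dvd_iff diff_diff_eq)
  qed
  have ge: "M + int t \<le> x" if "x + int t \<notin> S" for x
    using L that by (auto simp: subset_iff not_less[symmetric] M_def)
  let ?X = "{x \<in> S. x + int t \<notin> S}"
  have finX: "finite ?X" using finite_removable[OF assms(1), of "- int t"] by simp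
  have "(\<Sum>x\<in>?X. hook_weight t (slide S x (x + int t)))
      = (\<Sum>r\<in>?I. \<Sum>x\<in>{x \<in> ?X. ?c x = r}. hook_weight t (slide S x (x + int t)))"
    using finX assms(2) by (intro sum.group[symmetric]) auto
  also have "\<dots> = (\<Sum>r\<in>?I. hook_weight t S)"
  proof (rule sum.cong[OF refl])
    fix r assume r: "r \<in> ?I"
    have "{x \<in> ?X. ?c x = r} = {x. x \<in> runner t (M + r) S \<and> x + int t \<notin> S}"
      unfolding cr[OF r] using ge r by (fastforce simp: runner_def)
    then show "(\<Sum>x\<in>{x \<in> ?X. ?c x = r}. hook_weight t (slide S x (x + int t))) = hook_weight t S"
      using sum_additions_runner[OF assms Lr[OF r]] by simp
  qed
  finally show ?thesis by simp
qed

text \<open>Since \<open>hooks 1\<close> is in bijection with all boxes, this says how sliding a bead changes the weight.\<close>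

lemma card_hooks_one_slide:
  assumes "maya S" "x \<in> S" "y \<notin> S"
  shows "int (card (hooks 1 (slide S x y))) = int (card (hooks 1 S)) + y - x"
proof -
  obtain L where L: "{..<L} \<subseteq> S" using assms(1) by (rule maya_lower)
  define M where "M = min L (min x y)"
  have M: "{..<M} \<subseteq> S" "{..<M} \<subseteq> slide S x y" "M \<le> x" "M \<le> y"
    using L by (auto simp: M_def slide_def)
  have fin: "finite (runner 1 M S)" using assms(1) by (rule finite_runner)
  have R: "runner 1 M (slide S x y) = insert y (runner 1 M S - {x})" "x \<in> runner 1 M S" "y \<notin> runner 1 M S"
    using assms M by (auto simp: runner_def slide_def)
  then have "card (runner 1 M (slide S x y)) = card (runner 1 M S)"
    using fin by (simp add: card_Suc_Diff1 del: card_Diff_insert)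
  moreover have "(\<Sum>v\<in>runner 1 M (slide S x y). of_int (v - M))
      = (\<Sum>v\<in>runner 1 M S. of_int (v - M) :: rat) + of_int y - of_int x"
    unfolding R(1) using R(2,3) fin sum.remove[of "runner 1 M S" x "\<lambda>v. of_int (v - M) :: rat"] by simp
  ultimately have "(of_int (int (card (hooks 1 (slide S x y)))) :: rat) = of_int (int (card (hooks 1 S)) + y - x)"
    using card_hooks_runner[OF assms(1) _ M(1), of 1] card_hooks_runner[OF maya_slide[OF assms(1)] _ M(2), of 1]
    by simp
  then show ?thesis by (simp only: of_int_eq_iff)
qed

section \<open>Mirror symmetric bead sets\<close>

lemma card_hooks_slide_down:
  assumes "maya S" "t > 0" "x \<in> S" "x - int t \<notin> S"
  shows "int (card (hooks t (slide S x (x - int t)))) = int (card (hooks t S)) - 1"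
proof -
  interpret rib: ribbon_removal t S x "x - int t"
    using assms by unfold_locales auto
  show ?thesis using rib.card_hooks_slide by simp
qed

lemma card_hooks_slide_up:
  assumes "maya S" "t > 0" "x \<in> S" "x + int t \<notin> S"
  shows "int (card (hooks t (slide S x (x + int t)))) = int (card (hooks t S)) + 1"
  using card_hooks_slide_down[of "slide S x (x + int t)" t "x + int t"] assms
    slide_slide[of x S "x + int t"] maya_slide[OF assms(1)]
  by (auto simp: slide_def)

text \<open>The reflection is \<open>x \<mapsto> - e - x\<close>; self-conjugate partitions correspond to \<open>e = 1\<close> and doubled
  distinct ones to \<open>e = 0\<close>, where the fixed point \<open>0\<close> must not be a bead.\<close>

definition mirror :: "int \<Rightarrow> int set \<Rightarrow> bool" where
  "mirror e S \<longleftrightarrow> (\<forall>x. x \<in> S \<longleftrightarrow> - e - x \<notin> S \<and> 2 * x + e \<noteq> 0)"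

text \<open>For the bead set of a partition these are the a_i with i up to D, one for each diagonal
  box.\<close>

definition nonneg_beads :: "int set \<Rightarrow> int set" where
  "nonneg_beads S = {x \<in> S. 0 \<le> x}"

text \<open>The reflection has centre -e / 2, so these hooks have their midpoint to its left. On
  symmetric sets they are the boxes strictly above the diagonal.\<close>

definition above_hooks :: "nat \<Rightarrow> int \<Rightarrow> int set \<Rightarrow> (int \<times> int) set" where
  "above_hooks t e S = {(a, b) \<in> hooks t S. a + b + e < 0}"

text \<open>The sign delta times the product of the box signs over the counted hooks.\<close>

definition mirror_sign :: "nat \<Rightarrow> int \<Rightarrow> int set \<Rightarrow> rat" where
  "mirror_sign t e S = (-1) ^ (card (nonneg_beads S) + card (above_hooks t e S))"

text \<open>The reflection sends a hook \<open>(a, b)\<close> to \<open>(- e - b, - e - a)\<close> and exchanges the boxes above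
  and below the diagonal, except for the hooks on the diagonal and those whose hole \<open>b\<close> is the fixed
  point. The defect of \<open>a\<close> is \<open>2\<close> minus the number of exceptional hooks starting at \<open>a\<close>.\<close>

definition defect :: "nat \<Rightarrow> int \<Rightarrow> int \<Rightarrow> int" where
  "defect t e a = 2 - of_bool (int t dvd 2 * a + e) - of_bool (2 * int t dvd 2 * a + e)"

definition total_defect :: "nat \<Rightarrow> int \<Rightarrow> int set \<Rightarrow> int" where
  "total_defect t e S = (\<Sum>a\<in>nonneg_beads S. defect t e a)"

lemma finite_nonneg_beads: "maya S \<Longrightarrow> finite (nonneg_beads S)"
  unfolding nonneg_beads_def by (rule finite_maya_Ici)

lemma mirror_iff: "mirror e S \<Longrightarrow> x \<in> S \<longleftrightarrow> - e - x \<notin> S \<and> 2 * x + e \<noteq> 0"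
  unfolding mirror_def by blast

lemma mirrorD:
  assumes "mirror e S"
  shows "x \<in> S \<Longrightarrow> - e - x \<notin> S" "x \<in> S \<Longrightarrow> 2 * x + e \<noteq> 0"
    and "x \<notin> S \<Longrightarrow> 2 * x + e \<noteq> 0 \<Longrightarrow> - e - x \<in> S"
  using mirror_iff[OF assms, of x] by blast+

lemma mirror_flip:
  assumes "mirror e S" "x \<in> S"
  shows "mirror e (slide S x (- e - x))"
  unfolding mirror_def
proof
  fix z
  show "z \<in> slide S x (- e - x) \<longleftrightarrow> - e - z \<notin> slide S x (- e - x) \<and> 2 * z + e \<noteq> 0"
    unfolding slide_def insert_iff Diff_iff empty_iff
    using mirror_iff[OF assms(1), of x] mirror_iff[OF assms(1), of z] assms(2) by (smt (verit))
qed

lemma mirror_double: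
  assumes "mirror e S" "x \<in> S" "y \<notin> S" "y \<noteq> - e - x"
  shows "- e - y \<in> slide S x y" "- e - x \<notin> slide S x y"
    and "mirror e (slide (slide S x y) (- e - y) (- e - x))"
proof -
  note m = mirrorD[OF assms(1)]
  show "- e - y \<in> slide S x y"
    unfolding slide_def insert_iff Diff_iff empty_iff
    using m(3)[OF assms(3)] assms(4) by (smt (verit))
  show "- e - x \<notin> slide S x y"
    using m(1)[OF assms(2)] assms(4) by (auto simp: slide_def)
  show "mirror e (slide (slide S x y) (- e - y) (- e - x))"
    unfolding mirror_def
  proof
    fix z
    show "z \<in> slide (slide S x y) (- e - y) (- e - x) \<longleftrightarrow>
      - e - z \<notin> slide (slide S x y) (- e - y) (- e - x) \<and> 2 * z + e \<noteq> 0"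
      unfolding slide_def insert_iff Diff_iff empty_iff
      using mirror_iff[OF assms(1), of x] mirror_iff[OF assms(1), of y]
        mirror_iff[OF assms(1), of z] assms(2-4) by (smt (verit))
  qed
qed

lemma total_defect_slide:
  assumes "maya S" "x \<in> S" "y \<notin> S"
  shows "total_defect t e (slide S x y) = total_defect t e S
    - (if 0 \<le> x then defect t e x else 0) + (if 0 \<le> y then defect t e y else 0)"
proof -
  have fin: "finite (nonneg_beads S)" using assms(1) by (rule finite_nonneg_beads)
  have "nonneg_beads (slide S x y) = (if 0 \<le> y then {y} else {}) \<union> (nonneg_beads S - {x})"
    by (auto simp: nonneg_beads_def slide_def)
  moreover have "y \<notin> nonneg_beads S" using assms by (simp add: nonneg_beads_def)
  moreover have "x \<in> nonneg_beads S \<longleftrightarrow> 0 \<le> x" using assms by (simp add: nonneg_beads_def)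
  ultimately show ?thesis using fin by (auto simp: total_defect_def sum_diff1)
qed

text \<open>Expresses the exponent of the sign through the hook count and a sum over beads, both
  easy to follow under a slide. Reflection matches \<open>A\<close> with \<open>B\<close>; the hooks
  in \<open>Z\<close> are their own reflections, and those in \<open>X\<close> would be sent to a
  hook starting at the fixed point, which is not a bead.\<close>

lemma card_above_hooks:
  assumes "maya S" "mirror e S" "e = 0 \<or> e = 1"
  shows "2 * (int (card (nonneg_beads S)) + int (card (above_hooks t e S)))
    = int (card (hooks t S)) + total_defect t e S"
proof -
  let ?H = "hooks t S" and ?D = "nonneg_beads S"
  note m = mirrorD[OF assms(2)]
  define A where "A = {(a, b) \<in> ?H. a + b + e < 0}"
  define Z where "Z = {(a, b) \<in> ?H. a + b + e = 0}"
  define X where "X = {(a, b) \<in> ?H. a + b + e > 0 \<and> 2 * b + e = 0}"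
  define B where "B = {(a, b) \<in> ?H. a + b + e > 0 \<and> 2 * b + e \<noteq> 0}"
  have H: "?H = A \<union> (Z \<union> (X \<union> B))" "A \<inter> (Z \<union> (X \<union> B)) = {}" "Z \<inter> (X \<union> B) = {}" "X \<inter> B = {}"
    by (auto simp: A_def Z_def X_def B_def)
  have "finite ?H" using assms(1) by (rule finite_hooks)
  then have fin: "finite A" "finite Z" "finite X" "finite B"
    by (auto simp: A_def Z_def X_def B_def intro: finite_subset[rotated])
  have finD: "finite ?D" using assms(1) by (rule finite_nonneg_beads)
  have "bij_betw (\<lambda>(a, b). (- e - b, - e - a)) A B"
  proof (rule bij_betw_byWitness[where f' = "\<lambda>(a, b). (- e - b, - e - a)"])
    have "(- e - b, - e - a) \<in> B" if "(a, b) \<in> A" for a b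
    proof -
      have ab: "a \<in> S" "b \<notin> S" "b < a" "int t dvd a - b" "a + b + e < 0"
        using that by (auto simp: A_def hooks_def)
      then have "2 * b + e \<noteq> 0" by linarith
      then show ?thesis using ab m(1,2)[of a] m(3)[of b] by (auto simp: B_def hooks_def)
    qed
    then show "(\<lambda>(a, b). (- e - b, - e - a)) ` A \<subseteq> B" by auto
    have "(- e - b, - e - a) \<in> A" if "(a, b) \<in> B" for a b
    proof -
      have ab: "a \<in> S" "b \<notin> S" "b < a" "int t dvd a - b" "a + b + e > 0" "2 * b + e \<noteq> 0"
        using that by (auto simp: B_def hooks_def)
      then show ?thesis using m(1)[of a] m(3)[of b] by (auto simp: A_def hooks_def)
    qed
    then show "(\<lambda>(a, b). (- e - b, - e - a)) ` B \<subseteq> A" by auto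
  qed auto
  then have AB: "card A = card B" by (rule bij_betw_same_card)
  have "bij_betw fst Z {a \<in> ?D. int t dvd 2 * a + e}"
  proof (rule bij_betw_byWitness[where f' = "\<lambda>a. (a, - e - a)"])
    have "fst p \<in> {a \<in> ?D. int t dvd 2 * a + e}" if p: "p \<in> Z" for p
    proof -
      obtain a b where ab: "p = (a, b)" "a \<in> S" "b < a" "int t dvd a - b" "a + b + e = 0"
        using p by (auto simp: Z_def hooks_def)
      then have "a - b = 2 * a + e" by simp
      then have "int t dvd 2 * a + e" using ab(4) by metis
      then show ?thesis using ab assms(3) by (auto simp: nonneg_beads_def)
    qed
    then show "fst ` Z \<subseteq> {a \<in> ?D. int t dvd 2 * a + e}" by blast
    have "(a, - e - a) \<in> Z" if "a \<in> ?D" "int t dvd 2 * a + e" for a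
    proof -
      have "a - (- e - a) = 2 * a + e" by simp
      then show ?thesis using that m(1,2)[of a] assms(3) by (auto simp: Z_def hooks_def nonneg_beads_def)
    qed
    then show "(\<lambda>a. (a, - e - a)) ` {a \<in> ?D. int t dvd 2 * a + e} \<subseteq> Z" by auto
  qed (auto simp: Z_def)
  then have Z: "card Z = card {a \<in> ?D. int t dvd 2 * a + e}" by (rule bij_betw_same_card)
  \<comment> \<open>For \<open>e = 0\<close> the fixed point is 0, and t dividing a - 0 means that
    2t divides 2a. For \<open>e = 1\<close> there is no fixed point and 2a + 1 is odd, so both sides
    are empty.\<close>
  have X: "card X = card {a \<in> ?D. 2 * int t dvd 2 * a + e}"
    using assms(3)
  proof
    assume e: "e = 0"
    have "0 \<notin> S" using m(2)[of 0] e by auto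
    then have "bij_betw fst X {a \<in> ?D. 2 * int t dvd 2 * a + e}"
      by (intro bij_betw_byWitness[where f' = "\<lambda>a. (a, 0)"])
        (auto simp: X_def hooks_def nonneg_beads_def e order.strict_iff_order)
    then show ?thesis by (rule bij_betw_same_card)
  next
    assume e: "e = 1"
    have "\<not> 2 * int t dvd 2 * a + 1" for a
      by (metis dvd_mult_left dvd_triv_left even_plus_one_iff)
    moreover have "X = {}" unfolding X_def e by (auto, presburger)
    ultimately show ?thesis using e by simp
  qed
  have "total_defect t e S = 2 * int (card ?D) - int (card Z) - int (card X)"
    unfolding total_defect_def defect_def Z X using finD
    by (simp add: sum_subtractf sum.inter_filter[symmetric] of_bool_def)
  moreover have "card ?H = card A + (card Z + (card X + card B))"
    unfolding H(1) using H(2-4) fin by (simp add: card_Un_disjoint)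
  moreover have "A = above_hooks t e S" by (simp add: A_def above_hooks_def)
  ultimately show ?thesis using AB by simp
qed

text \<open>For exponents m and m' of the two signs, \<open>card_above_hooks\<close> turns the
  number divisible by 4 into 2(m - m') - 2, so m - m' is odd.\<close>

lemma mirror_sign_flip:
  assumes "maya S" "mirror e S" "maya S'" "mirror e S'" "e = 0 \<or> e = 1"
    and "4 dvd int (card (hooks t S)) + total_defect t e S
              - (int (card (hooks t S')) + total_defect t e S') - 2"
  shows "mirror_sign t e S' = - mirror_sign t e S"
proof -
  let ?n = "\<lambda>S. card (nonneg_beads S) + card (above_hooks t e S)"
  have "4 dvd 2 * int (?n S) - 2 * int (?n S') - 2"
    using assms(6) card_above_hooks[OF assms(1,2,5), of t] card_above_hooks[OF assms(3,4,5), of t]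
    by (simp add: algebra_simps)
  then have "odd (?n S) \<noteq> odd (?n S')" by presburger
  then show ?thesis unfolding mirror_sign_def by (auto simp: minus_one_power_iff)
qed

section \<open>The recurrence\<close>

text \<open>\<open>x0\<close> is the only bead whose removal of a \<open>t\<close>-ribbon keeps a mirror set mirror symmetric:
  it moves to its own reflection \<open>x0 - t = - e - x0\<close>.\<close>

locale mirror_setting =
  fixes t :: nat and e x0 :: int
  assumes t: "t > 0" and e: "e = 0 \<or> e = 1" and x0: "2 * x0 + e = int t"
begin

text \<open>An integer index spares truncation in j - 1 and j - 2; for negative \<open>j\<close> the
  set is empty.\<close>

definition states :: "int \<Rightarrow> int set set" where
  "states j = {S. maya S \<and> mirror e S \<and> int (card (hooks 1 S)) = int t * j \<and> int (card (hooks t S)) = j}"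

lemma states_maya: "S \<in> states j \<Longrightarrow> maya S"
  by (simp add: states_def)

definition signed_sum :: "int \<Rightarrow> rat" where
  "signed_sum j = (\<Sum>S\<in>states j. mirror_sign t e S * hook_weight t S)"

text \<open>A symmetric set is determined by its beads at or above 0. Flipping such a bead
  \<open>a\<close> to its reflection removes \<open>2 * a + e\<close> boxes, so \<open>a\<close> is
  bounded by the weight.\<close>

lemma finite_states: "finite (states j)"
proof -
  have "inj_on nonneg_beads (states j)"
  proof (rule inj_onI)
    fix S S' assume S: "S \<in> states j" "S' \<in> states j" "nonneg_beads S = nonneg_beads S'"
    then have *: "x \<in> S \<longleftrightarrow> x \<in> S'" if "0 \<le> x" for x
      using that by (auto simp: nonneg_beads_def)
    show "S = S'"
    proof (rule set_eqI)
      fix x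
      have "0 \<le> x \<or> 0 \<le> - e - x" using e by auto
      then show "x \<in> S \<longleftrightarrow> x \<in> S'"
        using * mirror_iff[of e S x] mirror_iff[of e S' x] S(1,2) unfolding states_def by blast
    qed
  qed
  moreover have "nonneg_beads ` states j \<subseteq> Pow {0..int t * j}"
  proof -
    have "a \<le> int t * j" if S: "S \<in> states j" and a: "a \<in> S" "0 \<le> a" for S a
    proof -
      have "maya S" "mirror e S" "int (card (hooks 1 S)) = int t * j" using S by (auto simp: states_def)
      with card_hooks_one_slide[of S a "- e - a"] mirrorD(1)[of e S a] a
      have "int t * j + (- e - a) - a \<ge> 0" by (metis of_nat_0_le_iff)
      then show ?thesis using a e by auto
    qed
    then show ?thesis by (auto simp: nonneg_beads_def)
  qed
  ultimately show ?thesis by (meson finite_Pow_iff finite_atLeastAtMost_int inj_on_finite)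
qed

lemma defect_x0: "defect t e x0 = 1"
proof -
  have "\<not> 2 * int t dvd int t" using t zdvd_not_zless[of "int t" "2 * int t"] zdvd_imp_le by fastforce
  then show ?thesis by (simp add: defect_def x0)
qed

text \<open>The hook count drops by 1 and so does the total defect, since \<open>x0\<close> has
  defect 1 and moves to a negative position. Twice the exponent of the sign therefore drops by
  2.\<close>

lemma single_down:
  assumes "S \<in> states j" "x0 \<in> S"
  shows "x0 - int t \<notin> S" "slide S x0 (x0 - int t) \<in> states (j - 1)"
    and "mirror_sign t e (slide S x0 (x0 - int t)) = - mirror_sign t e S"
proof -
  have S: "maya S" "mirror e S" "int (card (hooks 1 S)) = int t * j" "int (card (hooks t S)) = j"
    using assms by (auto simp: states_def)
  have r: "- e - x0 = x0 - int t" using x0 by simp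
  show n: "x0 - int t \<notin> S" using mirrorD(1)[OF S(2) assms(2)] r by simp
  let ?S = "slide S x0 (x0 - int t)"
  have S': "maya ?S" "mirror e ?S" using S maya_slide mirror_flip[OF S(2) assms(2)] r by auto
  have c: "int (card (hooks t ?S)) = j - 1"
    using card_hooks_slide_down[OF S(1) t assms(2) n] S by simp
  show "?S \<in> states (j - 1)"
    using S S' c card_hooks_one_slide[OF S(1) assms(2) n] by (simp add: states_def algebra_simps)
  have "0 \<le> x0" "\<not> 0 \<le> x0 - int t" using x0 e t by auto
  then have "total_defect t e ?S = total_defect t e S - 1"
    using total_defect_slide[OF S(1) assms(2) n] defect_x0 by simp
  then show "mirror_sign t e ?S = - mirror_sign t e S"
    using c S by (intro mirror_sign_flip S S' e) simp
qed

lemma single_up: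
  assumes "S \<in> states j" "x0 \<notin> S"
  shows "x0 - int t \<in> S" "slide S (x0 - int t) x0 \<in> states (j + 1)"
    and "mirror_sign t e (slide S (x0 - int t) x0) = - mirror_sign t e S"
proof -
  have S: "maya S" "mirror e S" "int (card (hooks 1 S)) = int t * j" "int (card (hooks t S)) = j"
    using assms by (auto simp: states_def)
  have r: "- e - (x0 - int t) = x0" "- e - x0 = x0 - int t" using x0 by simp_all
  show n: "x0 - int t \<in> S" using mirrorD(3)[OF S(2) assms(2)] r x0 t by simp
  let ?S = "slide S (x0 - int t) x0"
  have S': "maya ?S" "mirror e ?S" using S maya_slide mirror_flip[OF S(2) n] r by auto
  have c: "int (card (hooks t ?S)) = j + 1"
    using card_hooks_slide_up[OF S(1) t n] S assms(2) by simp
  show *: "?S \<in> states (j + 1)"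
    using S S' c card_hooks_one_slide[OF S(1) n assms(2)] by (simp add: states_def algebra_simps)
  have "x0 \<in> ?S" by (simp add: slide_def)
  from single_down(3)[OF * this] show "mirror_sign t e ?S = - mirror_sign t e S"
    using slide_slide[OF n assms(2)] by simp
qed

text \<open>Up to sign, the values of \<open>2 x + e\<close> at the four beads involved are congruent
  modulo \<open>2 t\<close>, so all four have the same defect.\<close>

lemma double_down:
  assumes "S \<in> states j" "x \<in> S" "x - int t \<notin> S" "x \<noteq> x0"
  defines "T \<equiv> slide S x (x - int t)"
  defines "S' \<equiv> slide T (- e - (x - int t)) (- e - x)"
  shows "- e - (x - int t) \<in> T" "- e - x \<notin> T" "S' \<in> states (j - 2)"
    and "mirror_sign t e S' = - mirror_sign t e S"
proof -
  let ?y = "x - int t"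
  have S: "maya S" "mirror e S" "int (card (hooks 1 S)) = int t * j" "int (card (hooks t S)) = j"
    using assms by (auto simp: states_def)
  have ne: "?y \<noteq> - e - x" using assms(4) x0 by auto
  show r: "- e - ?y \<in> T" "- e - x \<notin> T"
    using mirror_double[OF S(2) assms(2,3) ne] unfolding T_def by auto
  have mS': "mirror e S'"
    using mirror_double[OF S(2) assms(2,3) ne] unfolding T_def S'_def by auto
  have mT: "maya T" unfolding T_def by (rule maya_slide[OF S(1)])
  have mS: "maya S'" unfolding S'_def by (rule maya_slide[OF mT])
  have ry: "- e - x = - e - ?y - int t" by simp
  have cT: "int (card (hooks t T)) = j - 1" "int (card (hooks 1 T)) = int t * j - int t"
    using card_hooks_slide_down[OF S(1) t assms(2,3)] card_hooks_one_slide[OF S(1) assms(2,3)] S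
    by (auto simp: T_def)
  have cS: "int (card (hooks t S')) = j - 2"
    using card_hooks_slide_down[OF mT t r(1)] r(2) cT unfolding S'_def ry by simp
  show "S' \<in> states (j - 2)"
    using mS mS' cS cT card_hooks_one_slide[OF mT r]
    by (simp add: states_def S'_def algebra_simps)
  define z where "z = 2 * x + e"
  define h where "h v = (if 0 \<le> v then defect t e v else 0)" for v
  have z0: "z \<noteq> 0" "z \<noteq> int t" using mirrorD(2)[OF S(2) assms(2)] assms(4) x0 by (auto simp: z_def)
  have vals: "2 * ?y + e = z - 2 * int t" "2 * (- e - x) + e = - z" "2 * (- e - ?y) + e = 2 * int t - z"
    by (auto simp: z_def)
  have "int t dvd z - 2 * int t \<longleftrightarrow> int t dvd z" "2 * int t dvd z - 2 * int t \<longleftrightarrow> 2 * int t dvd z"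
    "int t dvd 2 * int t - z \<longleftrightarrow> int t dvd z" "2 * int t dvd 2 * int t - z \<longleftrightarrow> 2 * int t dvd z"
    by (simp_all add: dvd_diff_left_iff dvd_diff_right_iff)
  then have d: "defect t e ?y = defect t e x" "defect t e (- e - x) = defect t e x"
    "defect t e (- e - ?y) = defect t e x"
    unfolding defect_def vals z_def[symmetric] by simp_all
  \<comment> \<open>With d the common defect, the sum is 2d if 0 < z < 2t and 0 if z is negative or
    exceeds 2t. If 2t divides z then d = 0; if only t does, then 0 < z < 2t would force z = t, that
    is x = \<open>x0\<close>; otherwise d = 2.\<close>
  have "4 dvd h x - h ?y + h (- e - ?y) - h (- e - x)"
  proof (cases "2 * int t dvd z")
    case True
    then have "int t dvd z" by (rule dvd_mult_right)
    with True have "defect t e x = 0" by (simp add: defect_def z_def)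
    then show ?thesis using d by (simp add: h_def)
  next
    case not2: False
    then have z2: "z \<noteq> 2 * int t" by auto
    have sgn: "0 \<le> x \<longleftrightarrow> 0 < z" "0 \<le> - e - x \<longleftrightarrow> z < 0"
      "0 \<le> ?y \<longleftrightarrow> 2 * int t < z" "0 \<le> - e - ?y \<longleftrightarrow> z < 2 * int t"
      using z0 z2 e by (auto simp: z_def)
    have hv: "h x = (if 0 < z then defect t e x else 0)"
      "h (- e - x) = (if z < 0 then defect t e x else 0)"
      "h ?y = (if 2 * int t < z then defect t e x else 0)"
      "h (- e - ?y) = (if z < 2 * int t then defect t e x else 0)"
      unfolding h_def sgn d by (rule refl)+
    show ?thesis
    proof (cases "int t dvd z")
      case True
      have "\<not> (0 < z \<and> z < 2 * int t)"
      proof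
        assume *: "0 < z \<and> z < 2 * int t"
        obtain k where k: "z = int t * k" using True by (auto simp: dvd_def)
        with * have "0 < k" "k < 2" using t by (auto simp: zero_less_mult_iff)
        then have "k = 1" by simp
        with k z0 show False by simp
      qed
      then show ?thesis using z0 z2 t unfolding hv by auto
    next
      case False
      then have "defect t e x = 2" using not2 by (simp add: defect_def z_def)
      then show ?thesis using z0 z2 t unfolding hv by auto
    qed
  qed
  also have "h x - h ?y + h (- e - ?y) - h (- e - x)
      = int (card (hooks t S)) + total_defect t e S - (int (card (hooks t S')) + total_defect t e S') - 2"
    using total_defect_slide[OF S(1) assms(2,3), of t e] total_defect_slide[OF mT r, of t e] cS S(4)
    by (simp add: T_def S'_def h_def)
  finally show "mirror_sign t e S' = - mirror_sign t e S"
    by (intro mirror_sign_flip S mS mS' e)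
qed

text \<open>Needed only for the inverse map of the cancelling bijection; the comparison of signs is
  made from the removal side.\<close>

lemma double_up:
  assumes "S \<in> states j" "x \<in> S" "x + int t \<notin> S" "x \<noteq> x0 - int t"
  defines "T \<equiv> slide S x (x + int t)"
  defines "S' \<equiv> slide T (- e - (x + int t)) (- e - x)"
  shows "- e - (x + int t) \<in> T" "- e - x \<notin> T" "S' \<in> states (j + 2)"
proof -
  let ?y = "x + int t"
  have S: "maya S" "mirror e S" "int (card (hooks 1 S)) = int t * j" "int (card (hooks t S)) = j"
    using assms by (auto simp: states_def)
  have ne: "?y \<noteq> - e - x" using assms(4) x0 by auto
  show r: "- e - ?y \<in> T" "- e - x \<notin> T"
    using mirror_double[OF S(2) assms(2,3) ne] unfolding T_def by auto
  have mS': "mirror e S'"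
    using mirror_double[OF S(2) assms(2,3) ne] unfolding T_def S'_def by auto
  have mT: "maya T" unfolding T_def by (rule maya_slide[OF S(1)])
  have mS: "maya S'" unfolding S'_def by (rule maya_slide[OF mT])
  have ry: "- e - x = - e - ?y + int t" by simp
  have cT: "int (card (hooks t T)) = j + 1" "int (card (hooks 1 T)) = int t * j + int t"
    using card_hooks_slide_up[OF S(1) t assms(2,3)] card_hooks_one_slide[OF S(1) assms(2,3)] S
    by (auto simp: T_def)
  have cS: "int (card (hooks t S')) = j + 2"
    using card_hooks_slide_up[OF mT t r(1)] r(2) cT unfolding S'_def ry by simp
  show "S' \<in> states (j + 2)"
    using mS mS' cS cT card_hooks_one_slide[OF mT r]
    by (simp add: states_def S'_def algebra_simps)
qed

section \<open>Sums over all removals and additions of symmetric sets\<close>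

definition removals :: "int \<Rightarrow> (int set \<times> int) set" where
  "removals j = (SIGMA S:states j. {x \<in> S. x - int t \<notin> S})"

definition additions :: "int \<Rightarrow> (int set \<times> int) set" where
  "additions j = (SIGMA S:states j. {x \<in> S. x + int t \<notin> S})"

lemma finite_removals: "finite (removals j)" and finite_additions: "finite (additions j)"
  unfolding removals_def additions_def
  using finite_removable[of _ "int t"] finite_removable[of _ "- int t"] finite_states states_maya by (auto intro!: finite_SigmaI)

lemma sum_removals_states:
  "of_int j * signed_sum j
    = (\<Sum>(S, x)\<in>removals j. mirror_sign t e S * hook_weight t (slide S x (x - int t)))"
proof -
  have "(\<Sum>(S, x)\<in>removals j. mirror_sign t e S * hook_weight t (slide S x (x - int t)))
      = (\<Sum>S\<in>states j. \<Sum>x | x \<in> S \<and> x - int t \<notin> S.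
            mirror_sign t e S * hook_weight t (slide S x (x - int t)))"
    unfolding removals_def using finite_states finite_removable
    by (subst sum.Sigma) (auto simp: states_def)
  also have "\<dots> = (\<Sum>S\<in>states j. of_int j * (mirror_sign t e S * hook_weight t S))"
  proof (rule sum.cong[OF refl])
    fix S assume "S \<in> states j"
    then have S: "maya S" "of_nat (card (hooks t S)) = (of_int j :: rat)"
      by (auto simp: states_def)
    show "(\<Sum>x | x \<in> S \<and> x - int t \<notin> S. mirror_sign t e S * hook_weight t (slide S x (x - int t)))
        = of_int j * (mirror_sign t e S * hook_weight t S)"
      unfolding sum_distrib_left[symmetric] sum_removals[OF S(1) t] S(2) by simp
  qed
  finally show ?thesis by (simp add: signed_sum_def sum_distrib_left)
qed

lemma sum_additions_states:
  "of_nat t * signed_sum j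
    = (\<Sum>(S, x)\<in>additions j. mirror_sign t e S * hook_weight t (slide S x (x + int t)))"
proof -
  have "(\<Sum>(S, x)\<in>additions j. mirror_sign t e S * hook_weight t (slide S x (x + int t)))
      = (\<Sum>S\<in>states j. \<Sum>x | x \<in> S \<and> x + int t \<notin> S.
            mirror_sign t e S * hook_weight t (slide S x (x + int t)))"
    unfolding additions_def using finite_states finite_removable[of _ "- int t"]
    by (subst sum.Sigma) (auto simp: states_def)
  also have "\<dots> = (\<Sum>S\<in>states j. of_nat t * (mirror_sign t e S * hook_weight t S))"
  proof (rule sum.cong[OF refl])
    fix S assume "S \<in> states j"
    then have S: "maya S" by (auto simp: states_def)
    show "(\<Sum>x | x \<in> S \<and> x + int t \<notin> S. mirror_sign t e S * hook_weight t (slide S x (x + int t)))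
        = of_nat t * (mirror_sign t e S * hook_weight t S)"
      unfolding sum_distrib_left[symmetric] sum_additions[OF S(1) t] by simp
  qed
  finally show ?thesis by (simp add: signed_sum_def sum_distrib_left)
qed

text \<open>A removal at \<open>x0\<close> ends in a symmetric set without \<open>x0\<close>, and
  moving \<open>x0 - t\<close> back undoes it.\<close>

lemma sum_removals_x0:
  "(\<Sum>(S, x)\<in>{p \<in> removals j. snd p = x0}. mirror_sign t e S * hook_weight t (slide S x (x - int t)))
    = - (\<Sum>S | S \<in> states (j - 1) \<and> x0 \<notin> S. mirror_sign t e S * hook_weight t S)"
proof -
  have "(\<Sum>(S, x)\<in>{p \<in> removals j. snd p = x0}. mirror_sign t e S * hook_weight t (slide S x (x - int t)))
      = (\<Sum>S | S \<in> states (j - 1) \<and> x0 \<notin> S. - (mirror_sign t e S * hook_weight t S))"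
    using single_down single_up[of _ "j - 1"] t
    by (intro sum.reindex_bij_witness[where j = "\<lambda>(S, x). slide S x0 (x0 - int t)"
          and i = "\<lambda>S. (slide S (x0 - int t) x0, x0)"])
      (auto simp: removals_def slide_slide, (auto simp: slide_def)?)
  then show ?thesis by (simp add: sum_negf)
qed

text \<open>Complements the previous sum: for j - 2 in place of j it covers the sets of
  \<open>states (j - 1)\<close> that contain \<open>x0\<close>.\<close>

lemma sum_additions_x0:
  "(\<Sum>(S, x)\<in>{p \<in> additions j. snd p = x0 - int t}. mirror_sign t e S * hook_weight t (slide S x (x + int t)))
    = - (\<Sum>S | S \<in> states (j + 1) \<and> x0 \<in> S. mirror_sign t e S * hook_weight t S)"
proof -
  have "(\<Sum>(S, x)\<in>{p \<in> additions j. snd p = x0 - int t}. mirror_sign t e S * hook_weight t (slide S x (x + int t)))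
      = (\<Sum>S | S \<in> states (j + 1) \<and> x0 \<in> S. - (mirror_sign t e S * hook_weight t S))"
    using single_down[of _ "j + 1"] single_up t
    by (intro sum.reindex_bij_witness[where j = "\<lambda>(S, x). slide S (x0 - int t) x0"
          and i = "\<lambda>S. (slide S x0 (x0 - int t), x0 - int t)"])
      (auto simp: additions_def slide_slide, (auto simp: slide_def)?)
  then show ?thesis by (simp add: sum_negf)
qed

text \<open>A removal and the addition at the mirrored position pass through the same intermediate
  set, but start from sets of opposite signs.\<close>

lemma sum_removals_cancel:
  "(\<Sum>(S, x)\<in>{p \<in> removals j. snd p \<noteq> x0}. mirror_sign t e S * hook_weight t (slide S x (x - int t)))
    = - (\<Sum>(S, x)\<in>{p \<in> additions (j - 2). snd p \<noteq> x0 - int t}.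
          mirror_sign t e S * hook_weight t (slide S x (x + int t)))"
proof -
  let ?d = "\<lambda>S x. slide (slide S x (x - int t)) (- e - (x - int t)) (- e - x)"
  let ?u = "\<lambda>S x. slide (slide S x (x + int t)) (- e - (x + int t)) (- e - x)"
  have down: "?d S x \<in> states (j - 2)" "- e - x \<in> ?d S x" "- e - x + int t \<notin> ?d S x" "- e - x \<noteq> x0 - int t"
      "slide (?d S x) (- e - x) (- e - x + int t) = slide S x (x - int t)"
      "?u (?d S x) (- e - x) = S" "mirror_sign t e (?d S x) = - mirror_sign t e S"
    if "S \<in> states j" "x \<in> S" "x - int t \<notin> S" "x \<noteq> x0" for S x
  proof -
    note d = double_down[OF that]
    have r: "- e - (x - int t) = - e - x + int t" "- e - (- e - x + int t) = x - int t" "- e - (- e - x) = x" 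
      by simp_all
    show "?d S x \<in> states (j - 2)" "mirror_sign t e (?d S x) = - mirror_sign t e S" using d by auto
    show "- e - x \<in> ?d S x" "- e - x + int t \<notin> ?d S x" using t by (auto simp: slide_def)
    show "- e - x \<noteq> x0 - int t" using that(4) x0 by auto
    show 1: "slide (?d S x) (- e - x) (- e - x + int t) = slide S x (x - int t)"
      using slide_slide[OF d(1,2)] unfolding r by simp
    show "?u (?d S x) (- e - x) = S"
      unfolding 1 r(2,3) using slide_slide[OF that(2,3)] by simp
  qed
  have up: "?u S x \<in> states j" "- e - x \<in> ?u S x" "- e - x - int t \<notin> ?u S x" "- e - x \<noteq> x0"
      "?d (?u S x) (- e - x) = S"
    if "S \<in> states (j - 2)" "x \<in> S" "x + int t \<notin> S" "x \<noteq> x0 - int t" for S x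
  proof -
    note d = double_up[OF that]
    have r: "- e - (x + int t) = - e - x - int t" "- e - (- e - x - int t) = x + int t" "- e - (- e - x) = x" 
      by simp_all
    show "?u S x \<in> states j" using d(3) by simp
    show "- e - x \<in> ?u S x" "- e - x - int t \<notin> ?u S x" using t by (auto simp: slide_def)
    show "- e - x \<noteq> x0" using that(4) x0 by auto
    have 1: "slide (?u S x) (- e - x) (- e - x - int t) = slide S x (x + int t)"
      using slide_slide[OF d(1,2)] unfolding r by simp
    show "?d (?u S x) (- e - x) = S"
      unfolding 1 r(2,3) using slide_slide[OF that(2,3)] by simp
  qed
  have "(\<Sum>(S, x)\<in>{p \<in> removals j. snd p \<noteq> x0}. mirror_sign t e S * hook_weight t (slide S x (x - int t)))
    = (\<Sum>(S, x)\<in>{p \<in> additions (j - 2). snd p \<noteq> x0 - int t}.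
          - (mirror_sign t e S * hook_weight t (slide S x (x + int t))))"
  proof (rule sum.reindex_bij_witness[where j = "\<lambda>(S, x). (?d S x, - e - x)"
        and i = "\<lambda>(S, x). (?u S x, - e - x)"], goal_cases)
    case (1 p)
    obtain S x where p: "p = (S, x)" by (cases p)
    with 1 have *: "S \<in> states j" "x \<in> S" "x - int t \<notin> S" "x \<noteq> x0" by (auto simp: removals_def)
    show ?case unfolding p prod.case down(6)[OF *] by simp
  next
    case (2 p)
    obtain S x where p: "p = (S, x)" by (cases p)
    with 2 have *: "S \<in> states j" "x \<in> S" "x - int t \<notin> S" "x \<noteq> x0" by (auto simp: removals_def)
    show ?case using down(1-4)[OF *] unfolding p additions_def by simp
  next
    case (3 p)
    obtain S x where p: "p = (S, x)" by (cases p)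
    with 3 have *: "S \<in> states (j - 2)" "x \<in> S" "x + int t \<notin> S" "x \<noteq> x0 - int t" by (auto simp: additions_def)
    show ?case unfolding p prod.case up(5)[OF *] by simp
  next
    case (4 p)
    obtain S x where p: "p = (S, x)" by (cases p)
    with 4 have *: "S \<in> states (j - 2)" "x \<in> S" "x + int t \<notin> S" "x \<noteq> x0 - int t" by (auto simp: additions_def)
    show ?case using up(1-4)[OF *] unfolding p removals_def by simp
  next
    case (5 p)
    obtain S x where p: "p = (S, x)" by (cases p)
    with 5 have *: "S \<in> states j" "x \<in> S" "x - int t \<notin> S" "x \<noteq> x0" by (auto simp: removals_def)
    show ?case unfolding p prod.case down(5,7)[OF *] by simp
  qed
  then show ?thesis by (simp add: sum_negf case_prod_unfold)
qed

lemma signed_sum_recurrence: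
  "of_int j * signed_sum j = - signed_sum (j - 1) - of_nat t * signed_sum (j - 2)"
proof -
  let ?f = "\<lambda>(S, x). mirror_sign t e S * hook_weight t (slide S x (x - int t))"
  let ?g = "\<lambda>(S, x). mirror_sign t e S * hook_weight t (slide S x (x + int t))"
  let ?w = "\<lambda>S. mirror_sign t e S * hook_weight t S"
  have split: "sum f A = sum f {p \<in> A. P p} + sum f {p \<in> A. \<not> P p}"
    if "finite A" for f :: "'a \<Rightarrow> rat" and A P
  proof -
    have "A = {p \<in> A. P p} \<union> {p \<in> A. \<not> P p}" by auto
    then have "sum f A = sum f ({p \<in> A. P p} \<union> {p \<in> A. \<not> P p})" by simp
    also have "\<dots> = sum f {p \<in> A. P p} + sum f {p \<in> A. \<not> P p}"
      using that by (intro sum.union_disjoint) auto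
    finally show ?thesis .
  qed
  have "signed_sum (j - 1) = (\<Sum>S | S \<in> states (j - 1) \<and> x0 \<in> S. ?w S)
      + (\<Sum>S | S \<in> states (j - 1) \<and> x0 \<notin> S. ?w S)"
    unfolding signed_sum_def by (rule split[OF finite_states])
  moreover have "of_int j * signed_sum j = sum ?f {p \<in> removals j. snd p = x0} + sum ?f {p \<in> removals j. snd p \<noteq> x0}"
    unfolding sum_removals_states by (rule split[OF finite_removals])
  moreover have "of_nat t * signed_sum (j - 2) = sum ?g {p \<in> additions (j - 2). snd p = x0 - int t}
      + sum ?g {p \<in> additions (j - 2). snd p \<noteq> x0 - int t}"
    unfolding sum_additions_states by (rule split[OF finite_additions])
  ultimately show ?thesis
    using sum_removals_x0[of j] sum_additions_x0[of "j - 2"] sum_removals_cancel[of j] by simp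
qed

end

section \<open>Bead sets of partitions\<close>

lemma ferrers_iff: "(j, k) \<in> ferrers \<mu> \<longleftrightarrow> 1 \<le> j \<and> 1 \<le> k \<and> k \<le> part \<mu> j"
  by (auto simp: ferrers_def part_def split: if_splits)

lemma part_antimono:
  assumes "integer_partition \<mu>" "1 \<le> i" "i \<le> j"
  shows "part \<mu> j \<le> part \<mu> i"
proof (cases "part \<mu> j = 0")
  case False
  then have "(j, part \<mu> j) \<in> ferrers \<mu>" using assms by (auto simp: ferrers_iff)
  from ferrers_down_closed[OF assms(1) this assms(2,3) _ order_refl] False show ?thesis
    by (auto simp: ferrers_iff)
qed simp

lemma part_conj_partition_iff:
  assumes "integer_partition \<mu>" "1 \<le> j" "1 \<le> k"
  shows "j \<le> part (conj_partition \<mu>) k \<longleftrightarrow> k \<le> part \<mu> j"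
proof -
  have "(k, j) \<in> ferrers (conj_partition \<mu>) \<longleftrightarrow> (j, k) \<in> ferrers \<mu>"
    unfolding ferrers_conj_partition[OF assms(1)] by force
  then show ?thesis using assms by (simp add: ferrers_iff)
qed

text \<open>Indices beyond the length count too: there the part is 0 and the bead is -i, which fills
  the far negative range.\<close>

definition bead_set :: "nat list \<Rightarrow> int set" where
  "bead_set \<mu> = arm_coord \<mu> ` {1..}"

lemma integer_partition_part_pos:
  assumes "integer_partition \<mu>"
  shows "0 < part \<mu> i \<longleftrightarrow> 1 \<le> i \<and> i \<le> length \<mu>"
  using assms by (auto simp: integer_partition_def part_def)

context
  fixes \<mu> :: "nat list"
  assumes \<mu>: "integer_partition \<mu>"
begin

lemma arm_coord_strict: "1 \<le> i \<Longrightarrow> i < j \<Longrightarrow> arm_coord \<mu> j < arm_coord \<mu> i"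
  using part_antimono[OF \<mu>, of i j] by (simp add: arm_coord_def)

lemma arm_coord_inj: "1 \<le> i \<Longrightarrow> 1 \<le> j \<Longrightarrow> arm_coord \<mu> i = arm_coord \<mu> j \<longleftrightarrow> i = j"
  using arm_coord_strict[of i j] arm_coord_strict[of j i] by (cases i j rule: linorder_cases) auto

lemma leg_coord_strict:
  assumes "1 \<le> i" "i < j"
  shows "leg_coord \<mu> j < leg_coord \<mu> i"
proof -
  have "part (conj_partition \<mu>) j \<le> part (conj_partition \<mu>) i"
  proof (cases "part (conj_partition \<mu>) j = 0")
    case False
    then have "j \<le> part \<mu> (part (conj_partition \<mu>) j)"
      using part_conj_partition_iff[OF \<mu>, of "part (conj_partition \<mu>) j" j] assms by simp
    then show ?thesis
      using part_conj_partition_iff[OF \<mu>, of "part (conj_partition \<mu>) j" i] assms False by simp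
  qed simp
  then show ?thesis using assms by (simp add: leg_coord_def)
qed

lemma leg_coord_inj: "1 \<le> i \<Longrightarrow> 1 \<le> j \<Longrightarrow> leg_coord \<mu> i = leg_coord \<mu> j \<longleftrightarrow> i = j"
  using leg_coord_strict[of i j] leg_coord_strict[of j i] by (cases i j rule: linorder_cases) auto

text \<open>The difference of bead and hole is (part j - k) + (conjugate part k - j) + 1. Both
  brackets are nonnegative inside the diagram and both negative outside, so it is never 0.\<close>

lemma arm_leg_coord:
  assumes "1 \<le> j" "1 \<le> k"
  shows "(j, k) \<in> ferrers \<mu> \<longleftrightarrow> - 1 - leg_coord \<mu> k < arm_coord \<mu> j"
    and "- 1 - leg_coord \<mu> k \<noteq> arm_coord \<mu> j"
proof -
  have *: "j \<le> part (conj_partition \<mu>) k \<longleftrightarrow> k \<le> part \<mu> j"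
    using \<mu> assms by (rule part_conj_partition_iff)
  show "(j, k) \<in> ferrers \<mu> \<longleftrightarrow> - 1 - leg_coord \<mu> k < arm_coord \<mu> j"
    and "- 1 - leg_coord \<mu> k \<noteq> arm_coord \<mu> j"
    using assms * by (auto simp: ferrers_iff arm_coord_def leg_coord_def)
qed

text \<open>For a non-bead \<open>y\<close>, let row \<open>j\<close> be the first whose bead lies
  below \<open>y\<close>. Then column \<open>y + j\<close> ends just under that row.\<close>

lemma not_mem_bead_set_iff: "y \<notin> bead_set \<mu> \<longleftrightarrow> (\<exists>k\<ge>1. y = - 1 - leg_coord \<mu> k)"
proof
  assume y: "y \<notin> bead_set \<mu>"
  define P where "P j \<longleftrightarrow> 1 \<le> j \<and> arm_coord \<mu> j < y" for j
  have "P (length \<mu> + nat \<bar>y\<bar> + 1)" by (simp add: P_def arm_coord_def part_def)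
  then have P: "P (Least P)" and least: "\<And>i. i < Least P \<Longrightarrow> \<not> P i"
    by (rule LeastI, metis not_less_Least)
  define j where "j = Least P"
  have j: "1 \<le> j" "arm_coord \<mu> j < y" using P by (simp_all add: P_def j_def)
  \<comment> \<open>Solves y = -1 - (conjugate part k - k) for a column of height j - 1.\<close>
  define k where "k = nat (y + int j)"
  have k: "int k = y + int j" "1 \<le> k" using j(2) by (auto simp: k_def arm_coord_def)
  have "\<not> j \<le> part (conj_partition \<mu>) k"
    using part_conj_partition_iff[OF \<mu> j(1) k(2)] j(2) k(1) by (auto simp: arm_coord_def)
  moreover have "j - 1 \<le> part (conj_partition \<mu>) k"
  proof (cases "j = 1")
    case False
    then have "\<not> P (j - 1)" using j(1) least by (simp add: j_def)
    then have "y \<le> arm_coord \<mu> (j - 1)" using False j(1) by (auto simp: P_def)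
    moreover have "y \<noteq> arm_coord \<mu> (j - 1)" using y False j(1) by (auto simp: bead_set_def)
    ultimately have "k \<le> part \<mu> (j - 1)" using k(1) j(1) by (auto simp: arm_coord_def)
    then show ?thesis using part_conj_partition_iff[OF \<mu> _ k(2), of "j - 1"] False j(1) by simp
  qed simp
  ultimately have "part (conj_partition \<mu>) k = j - 1" by linarith
  then have "y = - 1 - leg_coord \<mu> k" using k j(1) by (simp add: leg_coord_def of_nat_diff)
  then show "\<exists>k\<ge>1. y = - 1 - leg_coord \<mu> k" using k(2) by blast
next
  assume "\<exists>k\<ge>1. y = - 1 - leg_coord \<mu> k"
  then show "y \<notin> bead_set \<mu>" using arm_leg_coord(2) by (auto simp: bead_set_def)
qed

lemma maya_bead_set: "maya (bead_set \<mu>)"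
proof -
  have "y \<in> bead_set \<mu>" if "y < - int (length \<mu>)" for y
    unfolding bead_set_def using that
    by (intro image_eqI[of _ _ "nat (- y)"]) (auto simp: arm_coord_def part_def)
  moreover have "y < int (part \<mu> 1)" if "y \<in> bead_set \<mu>" for y
    using that part_antimono[OF \<mu>, of 1] by (force simp: bead_set_def arm_coord_def)
  ultimately have "{..<- int (length \<mu>)} \<subseteq> bead_set \<mu>" "bead_set \<mu> \<subseteq> {..<int (part \<mu> 1)}" by auto
  then show ?thesis unfolding maya_def by blast
qed

lemma hook_length_eq:
  assumes "(j, k) \<in> ferrers \<mu>"
  shows "int (hook_length \<mu> (j, k)) = arm_coord \<mu> j - (- 1 - leg_coord \<mu> k)"
proof -
  have jk: "1 \<le> j" "1 \<le> k" "k \<le> part \<mu> j" "j \<le> part (conj_partition \<mu>) k"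
    using assms part_conj_partition_iff[OF \<mu>, of j k] by (auto simp: ferrers_iff)
  have "hook \<mu> (j, k) = Pair j ` {k..part \<mu> j} \<union> (\<lambda>i. (i, k)) ` {j<..part (conj_partition \<mu>) k}"
  proof (rule set_eqI)
    fix p :: "nat \<times> nat"
    obtain a b where p: "p = (a, b)" by (cases p)
    show "p \<in> hook \<mu> (j, k) \<longleftrightarrow>
        p \<in> Pair j ` {k..part \<mu> j} \<union> (\<lambda>i. (i, k)) ` {j<..part (conj_partition \<mu>) k}"
      using jk part_conj_partition_iff[OF \<mu>, of a k]
      by (cases "a = j") (auto simp: p hook_def ferrers_iff image_iff)
  qed
  moreover have "Pair j ` {k..part \<mu> j} \<inter> (\<lambda>i. (i, k)) ` {j<..part (conj_partition \<mu>) k} = {}" by auto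
  ultimately have "hook_length \<mu> (j, k) = (Suc (part \<mu> j) - k) + (part (conj_partition \<mu>) k - j)"
    by (simp add: hook_length_def card_Un_disjoint card_image inj_on_def)
  then show ?thesis using jk by (simp add: arm_coord_def leg_coord_def of_nat_diff)
qed

lemma bij_betw_hook_boxes:
  "bij_betw (\<lambda>(j, k). (arm_coord \<mu> j, - 1 - leg_coord \<mu> k)) (hook_boxes t \<mu>) (hooks t (bead_set \<mu>))"
  unfolding bij_betw_def
proof
  show "inj_on (\<lambda>(j, k). (arm_coord \<mu> j, - 1 - leg_coord \<mu> k)) (hook_boxes t \<mu>)"
    by (auto simp: inj_on_def hook_boxes_def ferrers_iff arm_coord_inj leg_coord_inj)
  have dvd: "t dvd hook_length \<mu> (j, k) \<longleftrightarrow> int t dvd arm_coord \<mu> j - (- 1 - leg_coord \<mu> k)"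
    if "(j, k) \<in> ferrers \<mu>" for j k
    unfolding hook_length_eq[OF that, symmetric] by simp
  show "(\<lambda>(j, k). (arm_coord \<mu> j, - 1 - leg_coord \<mu> k)) ` hook_boxes t \<mu> = hooks t (bead_set \<mu>)"
  proof (intro equalityI subsetI)
    fix p assume "p \<in> (\<lambda>(j, k). (arm_coord \<mu> j, - 1 - leg_coord \<mu> k)) ` hook_boxes t \<mu>"
    then obtain j k where p: "p = (arm_coord \<mu> j, - 1 - leg_coord \<mu> k)"
      and jk: "(j, k) \<in> ferrers \<mu>" "t dvd hook_length \<mu> (j, k)"
      by (auto simp: hook_boxes_def)
    have *: "1 \<le> j" "1 \<le> k" using jk by (auto simp: ferrers_iff)
    have "arm_coord \<mu> j \<in> bead_set \<mu>" using * by (auto simp: bead_set_def)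
    moreover have "- 1 - leg_coord \<mu> k \<notin> bead_set \<mu>" using * not_mem_bead_set_iff by blast
    ultimately show "p \<in> hooks t (bead_set \<mu>)"
      unfolding p hooks_def using jk arm_leg_coord(1)[OF *] dvd[OF jk(1)] by simp
  next
    fix p assume "p \<in> hooks t (bead_set \<mu>)"
    then obtain a b where p: "p = (a, b)" "a \<in> bead_set \<mu>" "b \<notin> bead_set \<mu>" "b < a" "int t dvd a - b"
      by (auto simp: hooks_def)
    then obtain j k where *: "1 \<le> j" "1 \<le> k" and ab: "a = arm_coord \<mu> j" "b = - 1 - leg_coord \<mu> k"
      using not_mem_bead_set_iff by (auto simp: bead_set_def)
    have "(j, k) \<in> ferrers \<mu>" using arm_leg_coord(1)[OF *] p ab by simp
    moreover from this have "t dvd hook_length \<mu> (j, k)" using dvd p(5) unfolding ab by simp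
    ultimately show "p \<in> (\<lambda>(j, k). (arm_coord \<mu> j, - 1 - leg_coord \<mu> k)) ` hook_boxes t \<mu>"
      unfolding p(1) ab hook_boxes_def by auto
  qed
qed

lemma card_hooks_bead_set: "card (hooks t (bead_set \<mu>)) = size (hook_mset t \<mu>)"
  using bij_betw_same_card[OF bij_betw_hook_boxes, of t] finite_ferrers[of \<mu>]
  by (simp add: hook_mset_def)

lemma card_hooks_one_bead_set: "card (hooks 1 (bead_set \<mu>)) = weight \<mu>"
proof -
  have "hook_boxes 1 \<mu> = (SIGMA j:{1..length \<mu>}. {1..part \<mu> j})"
    by (auto simp: hook_boxes_def ferrers_def)
  then have "card (hook_boxes 1 \<mu>) = (\<Sum>j\<in>{1..length \<mu>}. part \<mu> j)" by simp
  also have "\<dots> = (\<Sum>j<length \<mu>. \<mu> ! j)"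
    by (rule sum.reindex_bij_witness[where i = Suc and j = "\<lambda>j. j - 1"]) (auto simp: part_def)
  also have "\<dots> = weight \<mu>" by (simp add: sum_list_sum_nth atLeast0LessThan)
  finally show ?thesis using bij_betw_same_card[OF bij_betw_hook_boxes, of 1] by simp
qed

lemma le_durfee_iff:
  assumes "1 \<le> i"
  shows "i \<le> durfee \<mu> \<longleftrightarrow> 0 \<le> arm_coord \<mu> i" and "i \<le> durfee \<mu> \<longleftrightarrow> 0 \<le> leg_coord \<mu> i"
proof -
  let ?A = "{d. {1..d} \<times> {1..d} \<subseteq> ferrers \<mu>}"
  have A: "d \<in> ?A \<longleftrightarrow> d = 0 \<or> d \<le> part \<mu> d" for d
  proof (cases "d = 0")
    case False
    show ?thesis
    proof
      assume "d \<in> ?A"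
      then have "(d, d) \<in> ferrers \<mu>" using False by auto
      then show "d = 0 \<or> d \<le> part \<mu> d" by (simp add: ferrers_iff)
    next
      assume "d = 0 \<or> d \<le> part \<mu> d"
      then have "(d, d) \<in> ferrers \<mu>" using False by (simp add: ferrers_iff)
      then show "d \<in> ?A" using ferrers_down_closed[OF \<mu>] by auto
    qed
  qed simp
  have "d \<le> length \<mu>" if "d \<in> ?A" for d
    using iffD1[OF A that] by (auto simp: part_def split: if_splits)
  then have "finite ?A" by (intro finite_subset[of ?A "{..length \<mu>}"]) auto
  moreover have "0 \<in> ?A" by simp
  ultimately have "Max ?A \<in> ?A" by (intro Max_in) blast+
  moreover have "\<And>d. d \<in> ?A \<Longrightarrow> d \<le> Max ?A" using \<open>finite ?A\<close> by (rule Max_ge)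
  ultimately have D: "durfee \<mu> \<in> ?A" "\<And>d. d \<in> ?A \<Longrightarrow> d \<le> durfee \<mu>"
    unfolding durfee_def .
  have *: "i \<le> durfee \<mu> \<longleftrightarrow> i \<le> part \<mu> i"
  proof
    assume "i \<le> durfee \<mu>"
    then show "i \<le> part \<mu> i" using iffD1[OF A D(1)] part_antimono[OF \<mu> assms, of "durfee \<mu>"] assms by auto
  qed (use A D(2) in blast)
  then show "i \<le> durfee \<mu> \<longleftrightarrow> 0 \<le> arm_coord \<mu> i" by (simp add: arm_coord_def)
  show "i \<le> durfee \<mu> \<longleftrightarrow> 0 \<le> leg_coord \<mu> i"
    using * part_conj_partition_iff[OF \<mu> assms assms] by (simp add: leg_coord_def)
qed

lemma nonneg_beads_bead_set: "nonneg_beads (bead_set \<mu>) = arm_coord \<mu> ` {1..durfee \<mu>}"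
  using le_durfee_iff(1) by (auto simp: nonneg_beads_def bead_set_def)

lemma card_nonneg_beads_bead_set: "card (nonneg_beads (bead_set \<mu>)) = durfee \<mu>"
  unfolding nonneg_beads_bead_set by (subst card_image) (auto simp: inj_on_def arm_coord_inj)

end

text \<open>Mirror symmetry matches arms with legs only as sets; this makes the matching index by
  index.\<close>

lemma strict_mono_self_map_eq:
  fixes f :: "nat \<Rightarrow> nat"
  assumes range: "\<And>i. i \<in> {1..D} \<Longrightarrow> f i \<in> {1..D}"
    and mono: "\<And>i j. 1 \<le> i \<Longrightarrow> i < j \<Longrightarrow> j \<le> D \<Longrightarrow> f i < f j"
    and i: "i \<in> {1..D}"
  shows "f i = i"
proof -
  have "1 \<le> i \<Longrightarrow> i \<le> D \<Longrightarrow> i \<le> f i" for i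
  proof (induction i)
    case (Suc i)
    show ?case
    proof (cases "i = 0")
      case False
      with Suc mono[of i "Suc i"] show ?thesis by simp
    qed (use range[of "Suc i"] Suc in simp)
  qed simp
  moreover have "k < D \<Longrightarrow> f (D - k) \<le> D - k" for k
  proof (induction k)
    case 0
    then show ?case using range[of D] by simp
  next
    case (Suc k)
    then have "f (D - k) \<le> D - k" "D - k = Suc (D - Suc k)" "1 \<le> D - Suc k" by simp_all
    then show ?case using mono[of "D - Suc k" "D - k"] by linarith
  qed
  from this[of "D - i"] have "f i \<le> i" using i by simp
  ultimately show ?thesis using i by (simp add: le_antisym)
qed

text \<open>The equation says that the hole -1 - \<open>leg_coord \<mu> i\<close> is the reflection
  of the bead \<open>arm_coord \<mu> i\<close>. For the converse it suffices to treat nonnegative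
  beads and negative holes, since the reflection covers the rest.\<close>

lemma mirror_bead_set_iff:
  assumes \<mu>: "integer_partition \<mu>" and e: "e = 0 \<or> e = 1"
  shows "mirror e (bead_set \<mu>) \<longleftrightarrow> (\<forall>i\<in>{1..durfee \<mu>}. arm_coord \<mu> i = leg_coord \<mu> i + 1 - e)"
proof
  let ?S = "bead_set \<mu>" and ?D = "durfee \<mu>"
  assume m: "mirror e ?S"
  have "\<exists>k\<in>{1..?D}. leg_coord \<mu> k = arm_coord \<mu> i + e - 1" if i: "i \<in> {1..?D}" for i
  proof -
    have x: "arm_coord \<mu> i \<in> ?S" "0 \<le> arm_coord \<mu> i" using i le_durfee_iff[OF \<mu>] by (auto simp: bead_set_def)
    then have "- e - arm_coord \<mu> i \<notin> ?S" "2 * arm_coord \<mu> i + e \<noteq> 0" using mirrorD[OF m] by auto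
    then obtain k where k: "1 \<le> k" "- e - arm_coord \<mu> i = - 1 - leg_coord \<mu> k"
      using not_mem_bead_set_iff[OF \<mu>] by blast
    \<comment> \<open>For \<open>e = 0\<close> this fails only if the arm is 0, which is the fixed
      point and so not a bead.\<close>
    have "0 \<le> leg_coord \<mu> k" using k(2) x(2) e \<open>2 * arm_coord \<mu> i + e \<noteq> 0\<close> by auto
    then have "k \<in> {1..?D}" using k(1) le_durfee_iff[OF \<mu>] by auto
    then show ?thesis using k(2) by (intro bexI[of _ k]) auto
  qed
  then obtain f where f: "\<And>i. i \<in> {1..?D} \<Longrightarrow> f i \<in> {1..?D}"
      "\<And>i. i \<in> {1..?D} \<Longrightarrow> leg_coord \<mu> (f i) = arm_coord \<mu> i + e - 1"
    by metis
  have "f i < f j" if ij: "1 \<le> i" "i < j" "j \<le> ?D" for i j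
  proof (rule ccontr)
    assume "\<not> f i < f j"
    then have "leg_coord \<mu> (f i) \<le> leg_coord \<mu> (f j)"
      using leg_coord_strict[OF \<mu>, of "f j" "f i"] f(1)[of j] ij by (cases "f i = f j") auto
    then show False using f(2)[of i] f(2)[of j] ij arm_coord_strict[OF \<mu>, of i j] by simp
  qed
  then have "f i = i" if "i \<in> {1..?D}" for i
    using strict_mono_self_map_eq[of ?D f i] f(1) that by blast
  then show "\<forall>i\<in>{1..?D}. arm_coord \<mu> i = leg_coord \<mu> i + 1 - e" using f(2) by fastforce
next
  let ?S = "bead_set \<mu>" and ?D = "durfee \<mu>"
  assume eq: "\<forall>i\<in>{1..?D}. arm_coord \<mu> i = leg_coord \<mu> i + 1 - e"
  have bead: "- e - x \<notin> ?S" "2 * x + e \<noteq> 0" if x: "x \<in> ?S" "0 \<le> x" for x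
  proof -
    have "x \<in> nonneg_beads ?S" using x by (simp add: nonneg_beads_def)
    then obtain i where i: "i \<in> {1..?D}" "x = arm_coord \<mu> i"
      unfolding nonneg_beads_bead_set[OF \<mu>] by auto
    then have l: "x = leg_coord \<mu> i + 1 - e" "0 \<le> leg_coord \<mu> i"
      using bspec[OF eq i(1)] le_durfee_iff(2)[OF \<mu>, of i] by auto
    then have "- e - x = - 1 - leg_coord \<mu> i" by simp
    moreover have "1 \<le> i" using i(1) by simp
    ultimately show "- e - x \<notin> ?S" using not_mem_bead_set_iff[OF \<mu>] by blast
    show "2 * x + e \<noteq> 0" using l e by (smt (verit))
  qed
  have hole: "- e - y \<in> ?S" if y: "y \<notin> ?S" "y < 0" for y
  proof -
    obtain k where k: "1 \<le> k" "y = - 1 - leg_coord \<mu> k"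
      using not_mem_bead_set_iff[OF \<mu>] y(1) by blast
    then have "0 \<le> leg_coord \<mu> k" using y(2) by simp
    then have "k \<in> {1..?D}" using k(1) le_durfee_iff(2)[OF \<mu> k(1)] by auto
    then have "- e - y = arm_coord \<mu> k" using eq k(2) by simp
    then show ?thesis using k(1) by (auto simp: bead_set_def)
  qed
  show "mirror e ?S"
    unfolding mirror_def
  proof (intro allI iffI)
    fix x assume x: "x \<in> ?S"
    show "- e - x \<notin> ?S \<and> 2 * x + e \<noteq> 0"
    proof (cases "0 \<le> x")
      case False
      have "- e - x \<notin> ?S"
      proof
        assume "- e - x \<in> ?S"
        from bead(1)[OF this] x False e show False by auto
      qed
      then show ?thesis using False e by auto
    qed (use bead[OF x] in auto)
  next
    fix x assume x: "- e - x \<notin> ?S \<and> 2 * x + e \<noteq> 0"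
    show "x \<in> ?S"
    proof (cases "0 \<le> x")
      case True
      then have "- e - x < 0" using x e by auto
      then show ?thesis using hole[of "- e - x"] x by simp
    next
      case False
      then show ?thesis using hole[of x] x by linarith
    qed
  qed
qed

section \<open>Each symmetric bead set comes from exactly one partition\<close>

lemma inj_on_bead_set: "inj_on bead_set {\<mu>. integer_partition \<mu>}"
proof (rule inj_onI, clarify)
  fix \<mu> \<nu> :: "nat list"
  assume \<mu>: "integer_partition \<mu>" and \<nu>: "integer_partition \<nu>" and eq: "bead_set \<mu> = bead_set \<nu>"
  \<comment> \<open>The arms list the beads in decreasing order. If the earlier beads agree, the
    next bead of one partition is among the remaining beads of the other.\<close>
  have le: "arm_coord \<mu> i \<le> arm_coord \<nu> i"
    if "integer_partition \<mu>" "integer_partition \<nu>" "bead_set \<mu> = bead_set \<nu>" "1 \<le> i"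
      "\<And>k. 1 \<le> k \<Longrightarrow> k < i \<Longrightarrow> arm_coord \<mu> k = arm_coord \<nu> k" for \<mu> \<nu> i
  proof -
    have "arm_coord \<mu> i \<in> bead_set \<nu>" using that by (auto simp: bead_set_def)
    then obtain k where k: "1 \<le> k" "arm_coord \<mu> i = arm_coord \<nu> k" by (auto simp: bead_set_def)
    have "i \<le> k"
    proof (rule ccontr)
      assume "\<not> i \<le> k"
      with k that(4,5) have "arm_coord \<mu> i = arm_coord \<mu> k" by simp
      with arm_coord_inj[OF that(1,4) k(1)] \<open>\<not> i \<le> k\<close> show False by simp
    qed
    then show ?thesis using arm_coord_strict[OF that(2,4), of k] k(2) by (cases "i = k") auto
  qed
  have arm: "1 \<le> i \<Longrightarrow> arm_coord \<mu> i = arm_coord \<nu> i" for i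
  proof (induction i rule: less_induct)
    case (less i)
    then show ?case using le[OF \<mu> \<nu> eq, of i] le[OF \<nu> \<mu> eq[symmetric], of i]
      by (intro antisym) auto
  qed
  have part: "part \<mu> i = part \<nu> i" for i
  proof (cases "i = 0")
    case False
    then show ?thesis using arm[of i] by (simp add: arm_coord_def)
  qed (simp add: part_def)
  have len: "length \<mu> = length \<nu>"
    using integer_partition_part_pos[OF \<mu>] integer_partition_part_pos[OF \<nu>] part
    by (metis One_nat_def Suc_leI antisym le_refl neq0_conv not_less_eq_eq zero_le)
  show "\<mu> = \<nu>"
  proof (rule nth_equalityI[OF len])
    fix i assume "i < length \<mu>"
    then show "\<mu> ! i = \<nu> ! i" using part[of "Suc i"] len by (simp add: part_def)
  qed
qed

text \<open>Trailing zeros may be cut off, because \<open>part\<close> is 0 beyond the length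
  anyway.\<close>

lemma part_takeWhile_pos:
  assumes "sorted_wrt (\<ge>) ps"
  shows "part (takeWhile (\<lambda>p. 0 < p) ps) i = part ps i"
proof (cases "1 \<le> i \<and> i \<le> length ps")
  case True
  let ?m = "length (takeWhile (\<lambda>p. 0 < p) ps)"
  show ?thesis
  proof (cases "i \<le> ?m")
    case le: True
    then have "i - 1 < ?m" using True by linarith
    then show ?thesis using le True by (simp add: part_def takeWhile_nth)
  next
    case False
    then have m: "?m < length ps" "?m \<le> i - 1" using True by auto
    then have "ps ! ?m = 0" using nth_length_takeWhile[of "\<lambda>p. 0 < p" ps] by simp
    moreover have "ps ! (i - 1) \<le> ps ! ?m"
      using assms m True by (cases "?m = i - 1") (auto simp: sorted_wrt_iff_nth_less)
    ultimately show ?thesis using False True by (simp add: part_def)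
  qed
next
  case False
  then show ?thesis using length_takeWhile_le[of "\<lambda>p. 0 < p" ps] by (auto simp: part_def)
qed

text \<open>Mirror symmetry forces the charge of the bead set to be zero.\<close>

lemma mirror_card_beads:
  assumes "mirror e S" "e = 0 \<or> e = 1" "{..<- int m} \<subseteq> S" "finite {x \<in> S. 0 \<le> x}"
  shows "card {x \<in> S. - int m \<le> x} = m"
proof -
  let ?N = "{x \<in> S. - int m \<le> x \<and> x < 0}" and ?H = "{x. x \<notin> S \<and> - int m \<le> x \<and> x < 0}"
  note D = mirrorD[OF assms(1)]
  have fin: "finite ?N" "finite ?H" by (rule finite_subset[of _ "{- int m..0}"]; auto)+
  have "bij_betw (\<lambda>x. - e - x) {x \<in> S. 0 \<le> x} ?H"
  proof (rule bij_betw_byWitness[where f' = "\<lambda>x. - e - x"])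
    have "- e - x \<in> ?H" if "x \<in> S" "0 \<le> x" for x
    proof -
      have n: "- e - x \<notin> S" using D that by auto
      then have "- int m \<le> - e - x" using assms(3) by (metis lessThan_iff not_less subsetD)
      then show ?thesis using n D(2)[of x] that assms(2) by auto
    qed
    then show "(\<lambda>x. - e - x) ` {x \<in> S. 0 \<le> x} \<subseteq> ?H" by blast
    have "- e - x \<in> S \<and> 0 \<le> - e - x" if "x \<notin> S" "x < 0" for x
      using D(3)[of x] that assms(2) by auto
    then show "(\<lambda>x. - e - x) ` ?H \<subseteq> {x \<in> S. 0 \<le> x}" by blast
  qed auto
  then have "card {x \<in> S. 0 \<le> x} = card ?H" by (rule bij_betw_same_card)
  moreover have "{x \<in> S. - int m \<le> x} = ?N \<union> {x \<in> S. 0 \<le> x}" "?N \<inter> {x \<in> S. 0 \<le> x} = {}" by auto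
  moreover have "?N \<union> ?H = {- int m..<0}" "?N \<inter> ?H = {}" by auto
  then have "card ?N + card ?H = m" using fin by (simp flip: card_Un_disjoint)
  ultimately show ?thesis using fin assms(4) by (simp add: card_Un_disjoint)
qed

text \<open>Exactly \<open>m\<close> beads are at or above \<open>- m\<close>. So the i-th largest
  of them plus i is the i-th part, and the next index, m + 1, continues with the bead -m - 1 as an
  empty row does.\<close>

lemma bead_set_surj:
  assumes "maya S" "mirror e S" "e = 0 \<or> e = 1"
  shows "\<exists>\<mu>. integer_partition \<mu> \<and> bead_set \<mu> = S"
proof -
  obtain L where L: "{..<L} \<subseteq> S" using assms(1) by (rule maya_lower)
  define m where "m = nat (- L)"
  have m: "{..<- int m} \<subseteq> S" using L by (auto simp: m_def)
  let ?B = "{x \<in> S. - int m \<le> x}"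
  have fin: "finite ?B" using assms(1) by (rule finite_maya_Ici)
  have card: "card ?B = m"
    using mirror_card_beads[OF assms(2,3) m] finite_maya_Ici[OF assms(1)] by blast
  define xs where "xs = rev (sorted_list_of_set ?B)"
  have len: "length xs = m" and set: "set xs = ?B" using fin card by (simp_all add: xs_def)
  have "sorted_wrt (<) (sorted_list_of_set ?B)" by simp
  then have "sorted_wrt (>) xs" by (simp add: xs_def sorted_wrt_rev)
  then have dec: "xs ! j < xs ! i" if "i < j" "j < m" for i j
    using that len by (auto simp: sorted_wrt_iff_nth_less)
  have gap: "xs ! j + int (j - i) \<le> xs ! i" if "i \<le> j" "j < m" for i j
    using that
  proof (induction j)
    case (Suc j)
    then show ?case using dec[of j "Suc j"] by (cases "i = Suc j") (auto simp: of_nat_diff)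
  qed simp
  \<comment> \<open>At least m - 1 - i beads not below \<open>- m\<close> lie under
    \<open>xs ! i\<close>. Hence \<open>nat\<close> in the definition of \<open>ps\<close> loses
    nothing.\<close>
  have low: "0 \<le> xs ! i + int i + 1" if "i < m" for i
  proof -
    have "xs ! (m - 1) \<in> ?B" using that len set nth_mem[of "m - 1" xs] by auto
    moreover have "i \<le> m - 1" "int (m - 1 - i) = int m - 1 - int i" using that by auto
    ultimately show ?thesis using gap[of i "m - 1"] that by auto
  qed
  define ps where "ps = map (\<lambda>i. nat (xs ! i + int i + 1)) [0..<m]"
  define \<mu> where "\<mu> = takeWhile (\<lambda>p. 0 < p) ps"
  have ps: "sorted_wrt (\<ge>) ps"
    unfolding sorted_wrt_iff_nth_less
  proof (intro allI impI)
    fix i j assume "i < j" "j < length ps"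
    then show "ps ! j \<le> ps ! i" using gap[of i j] by (simp add: ps_def of_nat_diff)
  qed
  have "integer_partition \<mu>"
    unfolding integer_partition_def \<mu>_def
    using ps sorted_wrt_takeWhile[of "(\<ge>)" ps "\<lambda>p. 0 < p"] by (auto dest: set_takeWhileD)
  moreover have "bead_set \<mu> = S"
  proof -
    have part: "part \<mu> i = (if 1 \<le> i \<and> i \<le> m then nat (xs ! (i - 1) + int i) else 0)" for i
      unfolding \<mu>_def part_takeWhile_pos[OF ps] by (auto simp: part_def ps_def of_nat_diff)
    have arm: "arm_coord \<mu> i = (if i \<le> m then xs ! (i - 1) else - int i)" if "1 \<le> i" for i
      using that low[of "i - 1"] by (auto simp: arm_coord_def part of_nat_diff)
    show ?thesis
    proof (intro equalityI subsetI)
      fix x assume "x \<in> bead_set \<mu>"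
      then obtain i where i: "1 \<le> i" "x = arm_coord \<mu> i" by (auto simp: bead_set_def)
      show "x \<in> S"
      proof (cases "i \<le> m")
        case True
        then have "x \<in> set xs" using i arm[of i] len by simp
        then show ?thesis by (simp add: set)
      qed (use i arm[of i] m in auto)
    next
      fix x assume x: "x \<in> S"
      show "x \<in> bead_set \<mu>"
      proof (cases "- int m \<le> x")
        case True
        then have "x \<in> set xs" using x by (simp add: set)
        then obtain i where "i < m" "x = xs ! i" using len by (auto simp: in_set_conv_nth)
        then have "x = arm_coord \<mu> (Suc i)" using arm[of "Suc i"] by simp
        then show ?thesis by (auto simp: bead_set_def)
      next
        case False
        then have "1 \<le> nat (- x)" "\<not> nat (- x) \<le> m" by auto
        then have "x = arm_coord \<mu> (nat (- x))" using arm[of "nat (- x)"] by simp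
        then show ?thesis using False by (auto simp: bead_set_def)
      qed
    qed
  qed
  ultimately show ?thesis by blast
qed

section \<open>Coefficient extraction\<close>

text \<open>If column \<open>k\<close> meets the diagonal, its hole is -e -
  \<open>arm_coord \<mu> k\<close>, so the sum is the difference of the arms of \<open>j\<close> and
  \<open>k\<close>, negative exactly for j > k. Otherwise row \<open>j\<close> meets the diagonal, j
  < k, and both bead and hole are nonnegative.\<close>

lemma box_sign_bead_set:
  assumes \<mu>: "integer_partition \<mu>" and e: "e = 0 \<or> e = 1" and m: "mirror e (bead_set \<mu>)"
    and jk: "(j, k) \<in> ferrers \<mu>"
  shows "box_sign (j, k) = (if arm_coord \<mu> j + (- 1 - leg_coord \<mu> k) + e < 0 then -1 else 1)"
proof -
  have *: "1 \<le> j" "1 \<le> k" using jk by (auto simp: ferrers_iff)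
  show ?thesis
  proof (cases "k \<le> durfee \<mu>")
    case True
    then have "arm_coord \<mu> k = leg_coord \<mu> k + 1 - e"
      using mirror_bead_set_iff[OF \<mu> e] m * by simp
    then show ?thesis
      using arm_coord_strict[OF \<mu>, of j k] arm_coord_strict[OF \<mu>, of k j] *
      by (cases j k rule: linorder_cases) (auto simp: box_sign_def)
  next
    case False
    have j: "j \<le> durfee \<mu>"
    proof (rule ccontr)
      assume "\<not> j \<le> durfee \<mu>"
      then have "arm_coord \<mu> j < 0" "leg_coord \<mu> k < 0"
        using False le_durfee_iff[OF \<mu> *(1)] le_durfee_iff[OF \<mu> *(2)] by auto
      then show False using arm_leg_coord(1)[OF \<mu> *] jk by simp
    qed
    then have "0 \<le> arm_coord \<mu> j" "leg_coord \<mu> k < 0"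
      using False le_durfee_iff[OF \<mu> *(1)] le_durfee_iff[OF \<mu> *(2)] by auto
    then show ?thesis using j False e by (auto simp: box_sign_def)
  qed
qed

lemma delta_signed_hook_prod:
  assumes \<mu>: "integer_partition \<mu>" and e: "e = 0 \<or> e = 1" and m: "mirror e (bead_set \<mu>)"
  shows "delta \<mu> * signed_hook_prod t \<mu> = mirror_sign t e (bead_set \<mu>) * hook_weight t (bead_set \<mu>)"
proof -
  let ?S = "bead_set \<mu>" and ?s = "\<lambda>(a, b). if a + b + e < 0 then -1 else 1 :: rat"
  let ?w = "\<lambda>(a, b). of_nat t / of_int (a - b) :: rat"
  have "signed_hook_prod t \<mu> = (\<Prod>v\<in>hook_boxes t \<mu>.
      (\<lambda>p. ?w p * ?s p) ((\<lambda>(j, k). (arm_coord \<mu> j, - 1 - leg_coord \<mu> k)) v))"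
    unfolding signed_hook_prod_def
  proof (rule prod.cong[OF refl])
    fix v assume "v \<in> hook_boxes t \<mu>"
    then obtain j k where v: "v = (j, k)" "(j, k) \<in> ferrers \<mu>" by (cases v) (auto simp: hook_boxes_def)
    have "(of_nat (hook_length \<mu> v) :: rat) = of_int (int (hook_length \<mu> (j, k)))" by (simp add: v)
    moreover have "x / (y * (if P then -1 else 1)) = x / y * (if P then -1 else 1)" for x y :: rat and P
      by simp
    ultimately show "of_nat t / (of_nat (hook_length \<mu> v) * box_sign v)
        = (\<lambda>p. ?w p * ?s p) ((\<lambda>(j, k). (arm_coord \<mu> j, - 1 - leg_coord \<mu> k)) v)"
      by (simp only: hook_length_eq[OF \<mu> v(2)] box_sign_bead_set[OF \<mu> e m v(2)] v(1) prod.case)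
  qed
  also have "\<dots> = (\<Prod>p\<in>hooks t ?S. ?w p * ?s p)"
    by (rule prod.reindex_bij_betw[OF bij_betw_hook_boxes[OF \<mu>]])
  also have "\<dots> = hook_weight t ?S * prod ?s (hooks t ?S)"
    by (simp add: hook_weight_def prod.distrib)
  also have "prod ?s (hooks t ?S) = (\<Prod>p\<in>above_hooks t e ?S. -1)"
    using finite_hooks[OF maya_bead_set[OF \<mu>], of t]
    by (intro prod.mono_neutral_cong_right) (auto simp: above_hooks_def split: if_splits)
  finally show ?thesis
    by (simp add: delta_def mirror_sign_def card_nonneg_beads_bead_set[OF \<mu>] power_add mult_ac)
qed

section \<open>Transfer of the signed sums to partitions\<close>

context mirror_setting
begin

lemma sum_partitions:
  "(\<Sum>\<mu> | integer_partition \<mu> \<and> (\<forall>i\<in>{1..durfee \<mu>}. arm_coord \<mu> i = leg_coord \<mu> i + 1 - e)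
        \<and> weight \<mu> = t * n \<and> size (hook_mset t \<mu>) = n. delta \<mu> * signed_hook_prod t \<mu>)
    = signed_sum (int n)"
  (is "sum _ ?P = _")
proof -
  have iff: "bead_set \<mu> \<in> states (int n) \<longleftrightarrow> \<mu> \<in> ?P" if "integer_partition \<mu>" for \<mu>
  proof -
    have "int (weight \<mu>) = int t * int n \<longleftrightarrow> weight \<mu> = t * n" by (metis of_nat_eq_iff of_nat_mult)
    then show ?thesis
      unfolding states_def using that maya_bead_set[OF that]
        mirror_bead_set_iff[OF that e] card_hooks_bead_set[OF that, of t] card_hooks_one_bead_set[OF that]
      by auto
  qed
  have "bij_betw bead_set ?P (states (int n))"
    unfolding bij_betw_def
  proof
    show "inj_on bead_set ?P" by (rule inj_on_subset[OF inj_on_bead_set]) auto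
    show "bead_set ` ?P = states (int n)"
    proof (intro equalityI subsetI)
      fix S assume S: "S \<in> states (int n)"
      then obtain \<mu> where \<mu>: "integer_partition \<mu>" "bead_set \<mu> = S"
        using bead_set_surj[OF _ _ e] by (auto simp: states_def)
      then show "S \<in> bead_set ` ?P" using iff[OF \<mu>(1)] S by blast
    qed (use iff in auto)
  qed
  then have "signed_sum (int n) = (\<Sum>\<mu>\<in>?P. mirror_sign t e (bead_set \<mu>) * hook_weight t (bead_set \<mu>))"
    unfolding signed_sum_def by (rule sum.reindex_bij_betw[symmetric])
  also have "\<dots> = (\<Sum>\<mu>\<in>?P. delta \<mu> * signed_hook_prod t \<mu>)"
    using mirror_bead_set_iff[OF _ e]
    by (intro sum.cong refl delta_signed_hook_prod[symmetric] e) auto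
  finally show ?thesis by simp
qed

lemma signed_sum_neg: "j < 0 \<Longrightarrow> signed_sum j = 0"
  by (auto simp: signed_sum_def states_def intro!: sum.neutral)

text \<open>Evaluated on the side of partitions, where only the empty one has weight 0.\<close>

lemma signed_sum_0: "signed_sum 0 = 1"
proof -
  have ferrers: "ferrers [] = {}" by (auto simp: ferrers_iff part_def)
  have "{d :: nat. {1..d} \<times> {1..d} \<subseteq> {}} = {0}" by auto
  then have durfee: "durfee [] = 0" by (simp only: durfee_def ferrers Max_singleton)
  have "{\<mu>. integer_partition \<mu> \<and> (\<forall>i\<in>{1..durfee \<mu>}. arm_coord \<mu> i = leg_coord \<mu> i + 1 - e)
        \<and> weight \<mu> = t * 0 \<and> size (hook_mset t \<mu>) = 0} = {[]}"
  proof -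
    have "\<mu> = []" if "integer_partition \<mu>" "weight \<mu> = 0" for \<mu>
      using that by (cases \<mu>) (auto simp: integer_partition_def)
    then show ?thesis
      by (auto simp: integer_partition_def durfee ferrers hook_mset_def hook_boxes_def)
  qed
  then show ?thesis
    using sum_partitions[of 0]
    by (simp add: delta_def durfee signed_hook_prod_def hook_boxes_def ferrers)
qed

end

text \<open>With F = exp g one has x F' = F x g' and x g' = -p x^p - 2pc x^(2p). Comparing the
  coefficients of x^(pn) and dividing by p gives the recurrence; the case n = 1 guards against the
  truncated n - 2.\<close>

lemma fps_exp_compose_nth_recurrence:
  fixes c :: "'a::field_char_0"
  assumes "p > 0" "n > 0"
  defines "F \<equiv> fps_exp 1 oo (- (fps_X ^ p) - fps_const c * fps_X ^ (2 * p))"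
  shows "of_nat n * fps_nth F (p * n)
    = - fps_nth F (p * (n - 1)) - 2 * c * (if n = 1 then 0 else fps_nth F (p * (n - 2)))"
proof -
  let ?g = "- (fps_X ^ p) - fps_const c * fps_X ^ (2 * p) :: 'a fps"
  have "fps_deriv F = F * fps_deriv ?g"
    unfolding F_def using assms(1) by (subst fps_compose_deriv) simp_all
  then have "fps_X * fps_deriv F = F * (fps_X * fps_deriv ?g)" by (simp add: mult_ac)
  also have "fps_X * fps_deriv ?g
      = fps_const (- of_nat p) * fps_X ^ p - fps_const (2 * of_nat p * c) * fps_X ^ (2 * p)"
    unfolding fps_mult_fps_X_deriv_shift by (rule fps_ext) (auto simp: fps_X_power_nth)
  also have "F * \<dots> = fps_const (- of_nat p) * (F * fps_X ^ p)
      - fps_const (2 * of_nat p * c) * (F * fps_X ^ (2 * p))"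
    by (simp only: right_diff_distrib mult.left_commute)
  finally have "fps_nth (fps_X * fps_deriv F) (p * n)
      = fps_nth (fps_const (- of_nat p) * (F * fps_X ^ p)
          - fps_const (2 * of_nat p * c) * (F * fps_X ^ (2 * p))) (p * n)"
    by (rule arg_cong)
  then have "of_nat (p * n) * fps_nth F (p * n)
      = - of_nat p * (if p * n < p then 0 else fps_nth F (p * n - p))
        - 2 * of_nat p * c * (if p * n < 2 * p then 0 else fps_nth F (p * n - 2 * p))"
    unfolding fps_mult_fps_X_deriv_shift by (simp add: fps_X_power_mult_right_nth)
  moreover have "p * n - p = p * (n - 1)" "p * n - 2 * p = p * (n - 2)" by (simp_all add: algebra_simps)
  moreover have "p * n < p \<longleftrightarrow> False" "p * n < 2 * p \<longleftrightarrow> n = 1" using assms(1,2) by auto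
  ultimately have "of_nat p * (of_nat n * fps_nth F (p * n)) = of_nat p *
      (- fps_nth F (p * (n - 1)) - 2 * c * (if n = 1 then 0 else fps_nth F (p * (n - 2))))"
    by (simp only: if_False of_nat_mult) (simp add: algebra_simps)
  then show ?thesis using assms(1) by simp
qed

context mirror_setting
begin

text \<open>The series depends only on x^p, so p is free: it is t' for doubled distinct and t for
  self-conjugate partitions. The constant t/2 makes 2c equal to the factor t of the
  recurrence.\<close>

lemma signed_sum_eq_fps_nth:
  assumes "p > 0"
  shows "signed_sum (int n)
    = fps_nth (fps_exp 1 oo (- (fps_X ^ p) - fps_const (of_nat t / 2) * fps_X ^ (2 * p))) (p * n)"
    (is "_ = fps_nth ?F _")
proof (induction n rule: less_induct)
  case (less n)
  show ?case
  proof (cases "n = 0")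
    case False
    have "signed_sum (int n - 1) = fps_nth ?F (p * (n - 1))"
      using less[of "n - 1"] False by (simp add: of_nat_diff)
    moreover have "signed_sum (int n - 2) = (if n = 1 then 0 else fps_nth ?F (p * (n - 2)))"
      using less[of "n - 2"] False signed_sum_neg[of "-1"] by (auto simp: of_nat_diff)
    ultimately have "of_nat n * signed_sum (int n) = of_nat n * fps_nth ?F (p * n)"
      using signed_sum_recurrence[of "int n"] fps_exp_compose_nth_recurrence[OF assms, of n "of_nat t / 2 :: rat"] False
      by simp
    then show ?thesis using False by simp
  qed (simp add: signed_sum_0)
qed

end

theorem corollary3p3:
  fixes n t :: nat
  assumes "n > 0" and "t > 0"
  shows
    "(\<forall>t'. t = 2 * t' \<longrightarrow>
        (\<Sum>\<mu> | \<mu> \<in> DD \<and> weight \<mu> = t * n \<and> size (hook_mset t \<mu>) = n.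
            delta \<mu> * signed_hook_prod t \<mu>)
        = fps_nth (fps_exp (1::rat) oo (- (fps_X ^ t') - fps_const (of_nat t / 2) * fps_X ^ t))
            (t' * n)) \<and>
     (\<forall>t'. t = 2 * t' + 1 \<longrightarrow>
        (\<Sum>\<mu> | \<mu> \<in> SC \<and> weight \<mu> = t * n \<and> size (hook_mset t \<mu>) = n.
            delta \<mu> * signed_hook_prod t \<mu>)
        = fps_nth (fps_exp (1::rat) oo (- (fps_X ^ t) - fps_const (of_nat t / 2) * fps_X ^ (2 * t)))
            (t * n))"
proof (intro conjI allI impI)
  fix t' assume t': "t = 2 * t'"
  interpret mirror_setting t 0 "int t'"
    using assms t' by unfold_locales auto
  have "{\<mu>. \<mu> \<in> DD \<and> weight \<mu> = t * n \<and> size (hook_mset t \<mu>) = n}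
      = {\<mu>. integer_partition \<mu> \<and> (\<forall>i\<in>{1..durfee \<mu>}. arm_coord \<mu> i = leg_coord \<mu> i + 1 - 0)
          \<and> weight \<mu> = t * n \<and> size (hook_mset t \<mu>) = n}"
    by (auto simp: DD_def)
  moreover have "t' > 0" using assms t' by simp
  ultimately show "(\<Sum>\<mu> | \<mu> \<in> DD \<and> weight \<mu> = t * n \<and> size (hook_mset t \<mu>) = n.
            delta \<mu> * signed_hook_prod t \<mu>)
        = fps_nth (fps_exp (1::rat) oo (- (fps_X ^ t') - fps_const (of_nat t / 2) * fps_X ^ t)) (t' * n)"
    using sum_partitions[of n] signed_sum_eq_fps_nth[of t' n] t' by (simp only:)
next
  fix t' assume t': "t = 2 * t' + 1"
  interpret mirror_setting t 1 "int t'"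
    using assms t' by unfold_locales auto
  have "{\<mu>. \<mu> \<in> SC \<and> weight \<mu> = t * n \<and> size (hook_mset t \<mu>) = n}
      = {\<mu>. integer_partition \<mu> \<and> (\<forall>i\<in>{1..durfee \<mu>}. arm_coord \<mu> i = leg_coord \<mu> i + 1 - 1)
          \<and> weight \<mu> = t * n \<and> size (hook_mset t \<mu>) = n}"
    by (auto simp: SC_def)
  then show "(\<Sum>\<mu> | \<mu> \<in> SC \<and> weight \<mu> = t * n \<and> size (hook_mset t \<mu>) = n.
            delta \<mu> * signed_hook_prod t \<mu>)
        = fps_nth (fps_exp (1::rat) oo (- (fps_X ^ t) - fps_const (of_nat t / 2) * fps_X ^ (2 * t))) (t * n)"
    using sum_partitions[of n] signed_sum_eq_fps_nth[OF assms(2), of n] by (simp only:)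
qed

end
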